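(* The identity functor of $\mathbf{Cat}$ is neither a left Quillen adjoint nor a right Quillen adjoint between the q-model structure $(\mathbf{Cat})_q$ and the Ilias model structure $(\mathbf{Cat})_{DK}$; that is, neither $\mathrm{Id}:(\mathbf{Cat})_{DK}\to(\mathbf{Cat})_q$ nor $\mathrm{Id}:(\mathbf{Cat})_q\to(\mathbf{Cat})_{DK}$ is a left Quillen adjoint, and neither of them is a right Quillen adjoint.
   Context: $\mathbf{Top}$ denotes a locally presentable convenient category of topological spaces (for example, the category of $\Delta$-generated spaces), equipped with its q-model structure (weak equivalences: weak homotopy equivalences; q-fibrations: Serre fibrations). A flow is a small semicategory (a category without required identity maps) enriched over $(\mathbf{Top},\times)$: a flow $X$ consists of a set of states $X^0$, a space of execution paths $\mathbb{P}_{\alpha,\beta}X$ for each $(\alpha,\beta)\in X^0\times X^0$, and continuous associative composition maps. Maps of flows are the enriched semifunctors; the category of flows is $\mathbf{Flow}$. A set is viewed as a flow with empty space of execution paths. $\mathbf{Cat}$ is the category of small categories enriched over $\mathbf{Top}$; $\mathrm{Obj}(X)$ is the set of objects and $X(A,B)$ the space of morphisms from $A$ to $B$. The functor $I^+:\mathbf{Flow}\to\mathbf{Cat}$ is the left adjoint of the inclusion $\mathbf{Cat}\subset\mathbf{Flow}$; it adds identity maps as isolated points of the spaces of morphisms. For a space $Z$, $\mathrm{Glob}(Z)$ is the flow with states $\{0,1\}$, $\mathbb{P}_{0,1}\mathrm{Glob}(Z)=Z$ and no other execution paths. Let $\mathbf{D}^n$ be the $n$-dimensional disk and $\mathbf{S}^{n-1}$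 its boundary sphere, with $\mathbf{D}^0=\{0\}$ and $\mathbf{S}^{-1}=\varnothing$. Let $I^{gl}=\{\mathrm{Glob}(\mathbf{S}^{n-1})\subset\mathrm{Glob}(\mathbf{D}^n)\mid n\geq 0\}$, $C:\varnothing\to\{0\}$ and $R:\{0,1\}\to\{0\}$. $(\mathbf{Cat})_q$ is the combinatorial model structure on $\mathbf{Cat}$ with generating cofibrations $I^+(I^{gl}\cup\{C,R\})$, whose weak equivalences (resp. fibrations) are the enriched functors $f:X\to Y$ such that $\mathrm{Obj}(f)$ is a bijection and every $X(\alpha,\beta)\to Y(f(\alpha),f(\beta))$ is a weak homotopy equivalence (resp. such that every $X(\alpha,\beta)\to Y(f(\alpha),f(\beta))$ is a q-fibration of spaces). For a $\mathbf{Top}$-enriched small category $X$, $\vec{\pi}_1(X)$ is the small category with the same objects and with morphisms the path-connected components of the spaces of morphisms. The Ilias model structure $(\mathbf{Cat})_{DK}$ is the (known, unique) combinatorial model structure on $\mathbf{Cat}$ for which $I^+(I^{gl}\cup\{C\})$ is a set of generating cofibrations and the weak equivalences are the DK-equivalences, i.e. the enriched functors $F:\mathcal{C}\to\mathcal{D}$ such that $\vec{\pi}_1(F)$ is an equivalence of categories and $\mathcal{C}(\alpha,\beta)\to\mathcal{D}(F(\alpha),F(\beta))$ is a weak homotopy equivalence for all objects $\alpha,\beta$ of $\mathcal{C}$. *)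

theory Defs
  imports "HOL-Analysis.Analysis"
begin

section \<open>Categories\<close>

record ('o, 'a) cat =
  Ob :: "'o set"
  Ar :: "'a set"
  Dom :: "'a \<Rightarrow> 'o"
  Cod :: "'a \<Rightarrow> 'o"
  Idt :: "'o \<Rightarrow> 'a"
  Cmp :: "'a \<Rightarrow> 'a \<Rightarrow> 'a"  \<comment> \<open>\<open>Cmp C g f\<close> is \<open>g\<close> after \<open>f\<close>\<close>

definition homs :: "('o, 'a) cat \<Rightarrow> 'o \<Rightarrow> 'o \<Rightarrow> 'a set" where
  "homs C a b = {f \<in> Ar C. Dom C f = a \<and> Cod C f = b}"

definition is_category :: "('o, 'a) cat \<Rightarrow> bool" where
  "is_category C \<longleftrightarrow>
     (\<forall>f \<in> Ar C. Dom C f \<in> Ob C \<and> Cod C f \<in> Ob C) \<and>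
     (\<forall>a \<in> Ob C. Idt C a \<in> homs C a a) \<and>
     (\<forall>f \<in> Ar C. \<forall>g \<in> Ar C. Cod C f = Dom C g \<longrightarrow> Cmp C g f \<in> homs C (Dom C f) (Cod C g)) \<and>
     (\<forall>f \<in> Ar C. Cmp C f (Idt C (Dom C f)) = f \<and> Cmp C (Idt C (Cod C f)) f = f) \<and>
     (\<forall>f \<in> Ar C. \<forall>g \<in> Ar C. \<forall>h \<in> Ar C. Cod C f = Dom C g \<and> Cod C g = Dom C h \<longrightarrow>
        Cmp C h (Cmp C g f) = Cmp C (Cmp C h g) f)"

definition is_iso :: "('o, 'a) cat \<Rightarrow> 'a \<Rightarrow> bool" where
  "is_iso C f \<longleftrightarrow> f \<in> Ar C \<and> (\<exists>g \<in> homs C (Cod C f) (Dom C f).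
     Cmp C g f = Idt C (Dom C f) \<and> Cmp C f g = Idt C (Cod C f))"

record ('o, 'a, 'p, 'b) ftr =
  onOb :: "'o \<Rightarrow> 'p"
  onAr :: "'a \<Rightarrow> 'b"

definition is_functor ::
  "('o, 'a) cat \<Rightarrow> ('p, 'b) cat \<Rightarrow> ('o, 'a, 'p, 'b) ftr \<Rightarrow> bool" where
  "is_functor C D F \<longleftrightarrow>
     (\<forall>a \<in> Ob C. onOb F a \<in> Ob D \<and> onAr F (Idt C a) = Idt D (onOb F a)) \<and>
     (\<forall>f \<in> Ar C. onAr F f \<in> homs D (onOb F (Dom C f)) (onOb F (Cod C f))) \<and>
     (\<forall>f \<in> Ar C. \<forall>g \<in> Ar C. Cod C f = Dom C g \<longrightarrow>
        onAr F (Cmp C g f) = Cmp D (onAr F g) (onAr F f))"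

definition id_ftr :: "('o, 'a, 'o, 'a) ftr" where
  "id_ftr = \<lparr>onOb = (\<lambda>a. a), onAr = (\<lambda>f. f)\<rparr>"

definition comp_ftr ::
  "('p, 'b, 'q, 'c) ftr \<Rightarrow> ('o, 'a, 'p, 'b) ftr \<Rightarrow> ('o, 'a, 'q, 'c) ftr" where
  "comp_ftr G F = \<lparr>onOb = onOb G \<circ> onOb F, onAr = onAr G \<circ> onAr F\<rparr>"

definition naturally_isomorphic ::
  "('o, 'a) cat \<Rightarrow> ('p, 'b) cat \<Rightarrow> ('o, 'a, 'p, 'b) ftr \<Rightarrow> ('o, 'a, 'p, 'b) ftr \<Rightarrow> bool" where
  "naturally_isomorphic C D F G \<longleftrightarrow> (\<exists>\<tau>.
     (\<forall>a \<in> Ob C. \<tau> a \<in> homs D (onOb F a) (onOb G a) \<and> is_iso D (\<tau> a)) \<and>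
     (\<forall>f \<in> Ar C. Cmp D (\<tau> (Cod C f)) (onAr F f) = Cmp D (onAr G f) (\<tau> (Dom C f))))"

definition equivalence_of_categories ::
  "('o, 'a) cat \<Rightarrow> ('p, 'b) cat \<Rightarrow> ('o, 'a, 'p, 'b) ftr \<Rightarrow> bool" where
  "equivalence_of_categories C D F \<longleftrightarrow> is_functor C D F \<and>
     (\<exists>G. is_functor D C G \<and>
        naturally_isomorphic C C (comp_ftr G F) id_ftr \<and>
        naturally_isomorphic D D (comp_ftr F G) id_ftr)"

text \<open>\<open>F\<close> is left adjoint to \<open>G\<close>: a natural bijection \<open>D(F c, d) \<cong> C(c, G d)\<close>.\<close>

definition adjunction ::
  "('o, 'a) cat \<Rightarrow> ('p, 'b) cat \<Rightarrow> ('o, 'a, 'p, 'b) ftr \<Rightarrow> ('p, 'b, 'o, 'a) ftr \<Rightarrow> bool" where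
  "adjunction C D F G \<longleftrightarrow> is_functor C D F \<and> is_functor D C G \<and> (\<exists>\<Phi>.
     (\<forall>c \<in> Ob C. \<forall>d \<in> Ob D. bij_betw (\<Phi> c d) (homs D (onOb F c) d) (homs C c (onOb G d))) \<and>
     (\<forall>f \<in> Ar C. \<forall>g \<in> Ar D. \<forall>h \<in> homs D (onOb F (Cod C f)) (Dom D g).
        \<Phi> (Dom C f) (Cod D g) (Cmp D g (Cmp D h (onAr F f))) =
        Cmp C (onAr G g) (Cmp C (\<Phi> (Cod C f) (Dom D g) h) f)))"

definition universal_arrow ::
  "('o, 'a) cat \<Rightarrow> ('p, 'b) cat \<Rightarrow> ('p, 'b, 'o, 'a) ftr \<Rightarrow> 'o \<Rightarrow> 'p \<Rightarrow> 'a \<Rightarrow> bool" where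
  "universal_arrow C D G c d e \<longleftrightarrow> d \<in> Ob D \<and> e \<in> homs C c (onOb G d) \<and>
     (\<forall>d' \<in> Ob D. \<forall>f \<in> homs C c (onOb G d'). \<exists>!h. h \<in> homs D d d' \<and> Cmp C (onAr G h) e = f)"

text \<open>A left adjoint of \<open>G\<close> is a choice of universal arrows; \<open>left_adjoint_values C D G K\<close> collects
  the values on the arrows in \<open>K\<close> of all left adjoints of \<open>G\<close>, i.e. the value of one of them up to
  isomorphism.\<close>

definition left_adjoint_values ::
  "('o, 'a) cat \<Rightarrow> ('p, 'b) cat \<Rightarrow> ('p, 'b, 'o, 'a) ftr \<Rightarrow> 'a set \<Rightarrow> 'b set" where
  "left_adjoint_values C D G K = {f \<in> Ar D. \<exists>k \<in> K \<inter> Ar C. \<exists>e e'.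
     universal_arrow C D G (Dom C k) (Dom D f) e \<and>
     universal_arrow C D G (Cod C k) (Cod D f) e' \<and>
     Cmp C (onAr G f) e = Cmp C e' k}"


section \<open>Model structures\<close>

definition has_lifting :: "('o, 'a) cat \<Rightarrow> 'a \<Rightarrow> 'a \<Rightarrow> bool" where
  "has_lifting C i p \<longleftrightarrow>
     (\<forall>u \<in> homs C (Dom C i) (Dom C p). \<forall>v \<in> homs C (Cod C i) (Cod C p).
        Cmp C p u = Cmp C v i \<longrightarrow>
        (\<exists>h \<in> homs C (Cod C i) (Dom C p). Cmp C h i = u \<and> Cmp C p h = v))"

definition rlp :: "('o, 'a) cat \<Rightarrow> 'a set \<Rightarrow> 'a set" where
  "rlp C K = {p \<in> Ar C. \<forall>i \<in> K. has_lifting C i p}"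

definition retract_of_arrow :: "('o, 'a) cat \<Rightarrow> 'a \<Rightarrow> 'a \<Rightarrow> bool" where
  "retract_of_arrow C f g \<longleftrightarrow> f \<in> Ar C \<and> g \<in> Ar C \<and>
     (\<exists>s \<in> homs C (Dom C f) (Dom C g). \<exists>r \<in> homs C (Dom C g) (Dom C f).
      \<exists>s' \<in> homs C (Cod C f) (Cod C g). \<exists>r' \<in> homs C (Cod C g) (Cod C f).
        Cmp C r s = Idt C (Dom C f) \<and> Cmp C r' s' = Idt C (Cod C f) \<and>
        Cmp C g s = Cmp C s' f \<and> Cmp C f r = Cmp C r' g)"

record 'a model =
  Weq :: "'a set"
  Cof :: "'a set"
  Fib :: "'a set"

text \<open>Bicompleteness is a property of the underlying category, not of the three classes, and is not
  part of this definition.\<close>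

definition model_structure :: "('o, 'a) cat \<Rightarrow> 'a model \<Rightarrow> bool" where
  "model_structure C M \<longleftrightarrow> is_category C \<and>
     Weq M \<subseteq> Ar C \<and> Cof M \<subseteq> Ar C \<and> Fib M \<subseteq> Ar C \<and>
     (\<forall>f \<in> Ar C. \<forall>g \<in> Ar C. Cod C f = Dom C g \<longrightarrow>
        (f \<in> Weq M \<and> g \<in> Weq M \<longrightarrow> Cmp C g f \<in> Weq M) \<and>
        (f \<in> Weq M \<and> Cmp C g f \<in> Weq M \<longrightarrow> g \<in> Weq M) \<and>
        (g \<in> Weq M \<and> Cmp C g f \<in> Weq M \<longrightarrow> f \<in> Weq M)) \<and>
     (\<forall>K \<in> {Weq M, Cof M, Fib M}. \<forall>g \<in> K. \<forall>f. retract_of_arrow C f g \<longrightarrow> f \<in> K) \<and>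
     (\<forall>i \<in> Cof M. \<forall>p \<in> Fib M. i \<in> Weq M \<or> p \<in> Weq M \<longrightarrow> has_lifting C i p) \<and>
     (\<forall>f \<in> Ar C. \<exists>i \<in> Cof M \<inter> Weq M. \<exists>p \<in> Fib M. Cod C i = Dom C p \<and> Cmp C p i = f) \<and>
     (\<forall>f \<in> Ar C. \<exists>i \<in> Cof M. \<exists>p \<in> Fib M \<inter> Weq M. Cod C i = Dom C p \<and> Cmp C p i = f)"

definition generating_cofibrations :: "('o, 'a) cat \<Rightarrow> 'a model \<Rightarrow> 'a set \<Rightarrow> bool" where
  "generating_cofibrations C M K \<longleftrightarrow> K \<subseteq> Ar C \<and> Fib M \<inter> Weq M = rlp C K"

definition generating_trivial_cofibrations :: "('o, 'a) cat \<Rightarrow> 'a model \<Rightarrow> 'a set \<Rightarrow> bool" where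
  "generating_trivial_cofibrations C M K \<longleftrightarrow> K \<subseteq> Ar C \<and> Fib M = rlp C K"

definition left_quillen_adjoint ::
  "('o, 'a) cat \<Rightarrow> 'a model \<Rightarrow> ('p, 'b) cat \<Rightarrow> 'b model \<Rightarrow> ('o, 'a, 'p, 'b) ftr \<Rightarrow> bool" where
  "left_quillen_adjoint C M D N F \<longleftrightarrow> (\<exists>G. adjunction C D F G) \<and>
     onAr F ` Cof M \<subseteq> Cof N \<and> onAr F ` (Cof M \<inter> Weq M) \<subseteq> Cof N \<inter> Weq N"

definition right_quillen_adjoint ::
  "('o, 'a) cat \<Rightarrow> 'a model \<Rightarrow> ('p, 'b) cat \<Rightarrow> 'b model \<Rightarrow> ('o, 'a, 'p, 'b) ftr \<Rightarrow> bool" where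
  "right_quillen_adjoint C M D N G \<longleftrightarrow> (\<exists>F. adjunction D C F G) \<and>
     onAr G ` Fib M \<subseteq> Fib N \<and> onAr G ` (Fib M \<inter> Weq M) \<subseteq> Fib N \<inter> Weq N"


section \<open>Smallness and local presentability\<close>

text \<open>\<open>U\<close> is the family of small sets. Every Grothendieck universe containing an infinite set
  satisfies these conditions; so does the family of all subsets of a type \<open>'u\<close> with at least two
  elements and \<open>|real \<Rightarrow> 'u| = |'u|\<close>. The last condition keeps the small object argument for maps
  between disks and spheres inside the universe.\<close>

definition universe :: "'u set set \<Rightarrow> bool" where
  "universe U \<longleftrightarrow>
     (\<exists>a b. a \<noteq> b \<and> {a, b} \<in> U) \<and>
     (\<forall>A \<in> U. \<forall>B f. B \<subseteq> f ` A \<longrightarrow> B \<in> U) \<and>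
     (\<forall>A \<in> U. \<exists>e. inj_on e {g :: real \<Rightarrow> 'u. range g \<subseteq> A} \<and> e ` {g. range g \<subseteq> A} \<in> U)"

definition small :: "'u set set \<Rightarrow> 'x set \<Rightarrow> bool" where
  "small U S \<longleftrightarrow> (\<exists>A \<in> U. \<exists>g. S = g ` A)"

definition small_category :: "'u set set \<Rightarrow> ('u, 'u) cat \<Rightarrow> bool" where
  "small_category U J \<longleftrightarrow> is_category J \<and> small U (Ob J) \<and> small U (Ar J)"

definition is_cocone :: "('j, 'k) cat \<Rightarrow> ('o, 'a) cat \<Rightarrow> ('j, 'k, 'o, 'a) ftr \<Rightarrow>
    'o \<Rightarrow> ('j \<Rightarrow> 'a) \<Rightarrow> bool" where
  "is_cocone J C F c \<tau> \<longleftrightarrow> c \<in> Ob C \<and>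
     (\<forall>j \<in> Ob J. \<tau> j \<in> homs C (onOb F j) c) \<and>
     (\<forall>f \<in> Ar J. Cmp C (\<tau> (Cod J f)) (onAr F f) = \<tau> (Dom J f))"

definition is_colimit :: "('j, 'k) cat \<Rightarrow> ('o, 'a) cat \<Rightarrow> ('j, 'k, 'o, 'a) ftr \<Rightarrow>
    'o \<Rightarrow> ('j \<Rightarrow> 'a) \<Rightarrow> bool" where
  "is_colimit J C F c \<tau> \<longleftrightarrow> is_cocone J C F c \<tau> \<and>
     (\<forall>c' \<tau>'. is_cocone J C F c' \<tau>' \<longrightarrow>
        (\<exists>!h. h \<in> homs C c c' \<and> (\<forall>j \<in> Ob J. Cmp C h (\<tau> j) = \<tau>' j)))"

text \<open>Categories given by a preorder in which every set of fewer than \<open>|L|\<close> objects has an upper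
  bound.\<close>

definition directed_category :: "'u set \<Rightarrow> ('u, 'u) cat \<Rightarrow> bool" where
  "directed_category L J \<longleftrightarrow>
     (\<forall>a \<in> Ob J. \<forall>b \<in> Ob J. \<forall>f \<in> homs J a b. \<forall>g \<in> homs J a b. f = g) \<and>
     (\<forall>A \<subseteq> Ob J. (card_of A, card_of L) \<in> ordLess \<longrightarrow> (\<exists>b \<in> Ob J. \<forall>a \<in> A. homs J a b \<noteq> {}))"

text \<open>The functor \<open>C(a, -)\<close> preserves small \<open>|L|\<close>-directed colimits.\<close>

definition presentable_object :: "'u set set \<Rightarrow> 'u set \<Rightarrow> ('o, 'a) cat \<Rightarrow> 'o \<Rightarrow> bool" where
  "presentable_object U L C a \<longleftrightarrow> a \<in> Ob C \<and>
     (\<forall>J F c \<tau>. small_category U J \<and> directed_category L J \<and> is_functor J C F \<and> is_colimit J C F c \<tau> \<longrightarrow>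
        (\<forall>f \<in> homs C a c. \<exists>j \<in> Ob J. \<exists>g \<in> homs C a (onOb F j). Cmp C (\<tau> j) g = f) \<and>
        (\<forall>j \<in> Ob J. \<forall>g \<in> homs C a (onOb F j). \<forall>g' \<in> homs C a (onOb F j).
           Cmp C (\<tau> j) g = Cmp C (\<tau> j) g' \<longrightarrow>
           (\<exists>k \<in> Ar J. Dom J k = j \<and> Cmp C (onAr F k) g = Cmp C (onAr F k) g')))"

definition locally_presentable :: "'u set set \<Rightarrow> ('o, 'a) cat \<Rightarrow> bool" where
  "locally_presentable U C \<longleftrightarrow>
     (\<forall>J F. small_category U J \<and> is_functor J C F \<longrightarrow> (\<exists>c \<tau>. is_colimit J C F c \<tau>)) \<and>
     (\<exists>L \<in> U. infinite L \<and> regularCard (card_of L) \<and>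
        (\<exists>S. small U S \<and> (\<forall>s \<in> S. presentable_object U L C s) \<and>
           (\<forall>c \<in> Ob C. \<exists>J F \<tau>. small_category U J \<and> directed_category L J \<and> is_functor J C F \<and>
              onOb F ` Ob J \<subseteq> S \<and> is_colimit J C F c \<tau>)))"


section \<open>Spaces\<close>

text \<open>\<open>sphere_bd n\<close> is the boundary of the \<open>n\<close>-dimensional disk, of dimension \<open>n - 1\<close>; it is empty
  for \<open>n = 0\<close>.\<close>

definition disk :: "nat \<Rightarrow> (nat \<Rightarrow> real) topology" where
  "disk n = subtopology (Euclidean_space n) {x. (\<Sum>i<n. x i ^ 2) \<le> 1}"

definition sphere_bd :: "nat \<Rightarrow> (nat \<Rightarrow> real) topology" where
  "sphere_bd n = subtopology (Euclidean_space n) {x. (\<Sum>i<n. x i ^ 2) = 1}"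

definition open_cell :: "nat \<Rightarrow> (nat \<Rightarrow> real) set" where
  "open_cell n = topspace (disk n) - topspace (sphere_bd n)"

definition CW_complex :: "'u topology \<Rightarrow> bool" where
  "CW_complex X \<longleftrightarrow> Hausdorff_space X \<and> (\<exists>K :: (nat \<times> ((nat \<Rightarrow> real) \<Rightarrow> 'u)) set.
     (\<forall>(n, \<phi>) \<in> K. continuous_map (disk n) X \<phi> \<and> inj_on \<phi> (open_cell n) \<and>
        (\<exists>E \<subseteq> K. finite E \<and> (\<forall>(m, \<psi>) \<in> E. m < n) \<and>
           \<phi> ` topspace (sphere_bd n) \<subseteq> (\<Union>(m, \<psi>) \<in> E. \<psi> ` open_cell m))) \<and>
     (\<forall>(n, \<phi>) \<in> K. \<forall>(m, \<psi>) \<in> K. (n, \<phi>) \<noteq> (m, \<psi>) \<longrightarrow> \<phi> ` open_cell n \<inter> \<psi> ` open_cell m = {}) \<and>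
     topspace X = (\<Union>(n, \<phi>) \<in> K. \<phi> ` open_cell n) \<and>
     (\<forall>A \<subseteq> topspace X. (\<forall>(n, \<phi>) \<in> K. closedin (disk n) {t \<in> topspace (disk n). \<phi> t \<in> A}) \<longrightarrow>
        closedin X A))"

text \<open>\<open>f\<close> induces a bijection on path components and, for \<open>n \<ge> 1\<close> and all base points, a bijection
  (hence a group isomorphism) on the \<open>n\<close>-th homotopy groups, where the \<open>n\<close>-th homotopy group consists
  of the homotopy classes of maps of pairs from the \<open>n\<close>-disk and its boundary.\<close>

definition disk_loops :: "nat \<Rightarrow> 'x topology \<Rightarrow> 'x \<Rightarrow> ((nat \<Rightarrow> real) \<Rightarrow> 'x) set" where
  "disk_loops n X x = {g. continuous_map (disk n) X g \<and> (\<forall>t \<in> topspace (sphere_bd n). g t = x)}"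

definition loop_homotopy ::
  "nat \<Rightarrow> 'x topology \<Rightarrow> 'x \<Rightarrow> (((nat \<Rightarrow> real) \<Rightarrow> 'x) \<times> ((nat \<Rightarrow> real) \<Rightarrow> 'x)) set" where
  "loop_homotopy n X x = {(g, h). g \<in> disk_loops n X x \<and> h \<in> disk_loops n X x \<and>
     homotopic_with (\<lambda>k. \<forall>t \<in> topspace (sphere_bd n). k t = x) (disk n) X g h}"

definition homotopy_group :: "nat \<Rightarrow> 'x topology \<Rightarrow> 'x \<Rightarrow> ((nat \<Rightarrow> real) \<Rightarrow> 'x) set set" where
  "homotopy_group n X x = disk_loops n X x // loop_homotopy n X x"

definition weak_homotopy_equivalence :: "'x topology \<Rightarrow> 'y topology \<Rightarrow> ('x \<Rightarrow> 'y) \<Rightarrow> bool" where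
  "weak_homotopy_equivalence X Y f \<longleftrightarrow> continuous_map X Y f \<and>
     bij_betw (\<lambda>c. {y. \<exists>x \<in> c. path_component_of Y (f x) y})
       (path_components_of X) (path_components_of Y) \<and>
     (\<forall>n \<ge> 1. \<forall>x \<in> topspace X.
        bij_betw (\<lambda>c. loop_homotopy n Y (f x) `` ((\<lambda>g. f \<circ> g) ` c))
          (homotopy_group n X x) (homotopy_group n Y (f x)))"

definition serre_fibration :: "'x topology \<Rightarrow> 'y topology \<Rightarrow> ('x \<Rightarrow> 'y) \<Rightarrow> bool" where
  "serre_fibration X Y f \<longleftrightarrow> continuous_map X Y f \<and>
     (\<forall>n g H. continuous_map (disk n) X g \<and>
        continuous_map (prod_topology (disk n) (top_of_set {0..1::real})) Y H \<and>
        (\<forall>t \<in> topspace (disk n). H (t, 0) = f (g t)) \<longrightarrow>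
        (\<exists>K. continuous_map (prod_topology (disk n) (top_of_set {0..1::real})) X K \<and>
           (\<forall>t \<in> topspace (disk n). K (t, 0) = g t) \<and>
           (\<forall>t \<in> topspace (disk n). \<forall>s \<in> {0..1}. f (K (t, s)) = H (t, s))))"


subsection \<open>Convenient categories of spaces\<close>

text \<open>The full subcategory of topological spaces spanned by \<open>T\<close>.\<close>

definition space_cat ::
  "'u topology set \<Rightarrow> ('u topology, 'u topology \<times> 'u topology \<times> ('u \<Rightarrow> 'u)) cat" where
  "space_cat T = \<lparr>
     Ob = T,
     Ar = {(X, Y, f). X \<in> T \<and> Y \<in> T \<and> f \<in> extensional (topspace X) \<and> continuous_map X Y f},
     Dom = (\<lambda>(X, Y, f). X),
     Cod = (\<lambda>(X, Y, f). Y),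
     Idt = (\<lambda>X. (X, X, restrict id (topspace X))),
     Cmp = (\<lambda>(Y', Z, g) (X, Y, f). (X, Z, compose (topspace X) g f))\<rparr>"

text \<open>The product of \<open>X\<close> and \<open>Y\<close> in the category spanned by \<open>T\<close>, transported to the set of pairs. Its
  topology is in general finer than that of \<^const>\<open>prod_topology\<close>.\<close>

definition is_product ::
  "'u topology set \<Rightarrow> 'u topology \<Rightarrow> 'u topology \<Rightarrow> ('u \<times> 'u) topology \<Rightarrow> bool" where
  "is_product T X Y P \<longleftrightarrow> (\<exists>Z \<in> T. P homeomorphic_space Z) \<and>
     topspace P = topspace X \<times> topspace Y \<and> continuous_map P X fst \<and> continuous_map P Y snd \<and>
     (\<forall>W \<in> T. \<forall>f g. continuous_map W X f \<and> continuous_map W Y g \<longrightarrow>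
        continuous_map W P (\<lambda>w. (f w, g w)))"

definition continuous_on_product ::
  "'u topology set \<Rightarrow> 'u topology \<Rightarrow> 'u topology \<Rightarrow> 'u topology \<Rightarrow> ('u \<Rightarrow> 'u \<Rightarrow> 'u) \<Rightarrow> bool" where
  "continuous_on_product T X Y Z m \<longleftrightarrow>
     (\<exists>P. is_product T X Y P \<and> continuous_map P Z (\<lambda>(x, y). m x y))"

definition is_exponential ::
  "'u topology set \<Rightarrow> 'u topology \<Rightarrow> 'u topology \<Rightarrow> 'u topology \<Rightarrow> ('u \<Rightarrow> 'u \<Rightarrow> 'u) \<Rightarrow> bool" where
  "is_exponential T X Y E ev \<longleftrightarrow> E \<in> T \<and> continuous_on_product T E X Y ev \<and>
     (\<forall>W \<in> T. \<forall>h. continuous_on_product T W X Y h \<longrightarrow>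
        (\<exists>!k. k \<in> extensional (topspace W) \<and> continuous_map W E k \<and>
           (\<forall>w \<in> topspace W. \<forall>x \<in> topspace X. ev (k w) x = h w x)))"

text \<open>The underlying set of an exponential is in bijection with the set of continuous maps. It is
  always small if \<open>U\<close> is a Grothendieck universe, and exponentials are only required if it is.\<close>

definition convenient_category :: "'u set set \<Rightarrow> 'u topology set \<Rightarrow> bool" where
  "convenient_category U T \<longleftrightarrow>
     (\<forall>X \<in> T. topspace X \<in> U) \<and>
     (\<forall>X \<in> T. \<forall>Y :: 'u topology. X homeomorphic_space Y \<longrightarrow> Y \<in> T) \<and>
     (\<forall>X. CW_complex X \<and> topspace X \<in> U \<longrightarrow> X \<in> T) \<and>
     (\<forall>X \<in> T. \<forall>Y \<in> T. \<exists>P. is_product T X Y P) \<and>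
     (\<forall>X \<in> T. \<forall>Y \<in> T. small U {f \<in> extensional (topspace X). continuous_map X Y f} \<longrightarrow>
        (\<exists>E ev. is_exponential T X Y E ev)) \<and>
     locally_presentable U (space_cat T)"


section \<open>Flows and enriched categories\<close>

text \<open>Composition is written in diagrammatic order: \<open>pcomp X a b c x y\<close> is \<open>x\<close> from \<open>a\<close> to \<open>b\<close> followed
  by \<open>y\<close> from \<open>b\<close> to \<open>c\<close>. The fields are only meaningful on states; what they are elsewhere is not
  constrained, so that a flow has several isomorphic copies.\<close>

record 'u flow =
  states :: "'u set"
  paths :: "'u \<Rightarrow> 'u \<Rightarrow> 'u topology"
  pcomp :: "'u \<Rightarrow> 'u \<Rightarrow> 'u \<Rightarrow> 'u \<Rightarrow> 'u \<Rightarrow> 'u"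

record 'u topcat = "'u flow" +
  ident :: "'u \<Rightarrow> 'u"

definition is_flow :: "'u set set \<Rightarrow> 'u topology set \<Rightarrow> ('u, 'z) flow_scheme \<Rightarrow> bool" where
  "is_flow U T X \<longleftrightarrow> states X \<in> U \<and>
     (\<forall>a \<in> states X. \<forall>b \<in> states X. paths X a b \<in> T) \<and>
     (\<forall>a \<in> states X. \<forall>b \<in> states X. \<forall>c \<in> states X.
        continuous_on_product T (paths X a b) (paths X b c) (paths X a c) (pcomp X a b c)) \<and>
     (\<forall>a \<in> states X. \<forall>b \<in> states X. \<forall>c \<in> states X. \<forall>d \<in> states X.
        \<forall>x \<in> topspace (paths X a b). \<forall>y \<in> topspace (paths X b c). \<forall>z \<in> topspace (paths X c d).
          pcomp X a c d (pcomp X a b c x y) z = pcomp X a b d x (pcomp X b c d y z))"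

definition is_topcat :: "'u set set \<Rightarrow> 'u topology set \<Rightarrow> 'u topcat \<Rightarrow> bool" where
  "is_topcat U T X \<longleftrightarrow> is_flow U T X \<and>
     (\<forall>a \<in> states X. ident X a \<in> topspace (paths X a a)) \<and>
     (\<forall>a \<in> states X. \<forall>b \<in> states X. \<forall>x \<in> topspace (paths X a b).
        pcomp X a a b (ident X a) x = x \<and> pcomp X a b b x (ident X b) = x)"

record ('u, 'f) emap =
  src :: 'f
  tgt :: 'f
  omap :: "'u \<Rightarrow> 'u"
  mmap :: "'u \<Rightarrow> 'u \<Rightarrow> 'u \<Rightarrow> 'u"

definition carr :: "('u, 'z) flow_scheme \<Rightarrow> 'u \<Rightarrow> 'u \<Rightarrow> 'u set" where
  "carr X a b = (if a \<in> states X \<and> b \<in> states X then topspace (paths X a b) else {})"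

definition is_semifunctor :: "('u, ('u, 'z) flow_scheme) emap \<Rightarrow> bool" where
  "is_semifunctor f \<longleftrightarrow>
     omap f \<in> states (src f) \<rightarrow>\<^sub>E states (tgt f) \<and>
     (\<forall>a b. mmap f a b \<in> extensional (carr (src f) a b)) \<and>
     (\<forall>a \<in> states (src f). \<forall>b \<in> states (src f).
        continuous_map (paths (src f) a b) (paths (tgt f) (omap f a) (omap f b)) (mmap f a b)) \<and>
     (\<forall>a \<in> states (src f). \<forall>b \<in> states (src f). \<forall>c \<in> states (src f).
        \<forall>x \<in> topspace (paths (src f) a b). \<forall>y \<in> topspace (paths (src f) b c).
          mmap f a c (pcomp (src f) a b c x y) =
          pcomp (tgt f) (omap f a) (omap f b) (omap f c) (mmap f a b x) (mmap f b c y))"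

definition id_emap :: "('u, 'z) flow_scheme \<Rightarrow> ('u, ('u, 'z) flow_scheme) emap" where
  "id_emap X = \<lparr>src = X, tgt = X, omap = restrict id (states X),
     mmap = (\<lambda>a b. restrict id (carr X a b))\<rparr>"

definition comp_emap :: "('u, ('u, 'z) flow_scheme) emap \<Rightarrow> ('u, ('u, 'z) flow_scheme) emap \<Rightarrow>
    ('u, ('u, 'z) flow_scheme) emap" where
  "comp_emap g f = \<lparr>src = src f, tgt = tgt g,
     omap = compose (states (src f)) (omap g) (omap f),
     mmap = (\<lambda>a b. compose (carr (src f) a b) (mmap g (omap f a) (omap f b)) (mmap f a b))\<rparr>"

definition flow_cat ::
  "'u set set \<Rightarrow> 'u topology set \<Rightarrow> ('u flow, ('u, 'u flow) emap) cat" where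
  "flow_cat U T = \<lparr>
     Ob = {X. is_flow U T X},
     Ar = {f. is_flow U T (src f) \<and> is_flow U T (tgt f) \<and> is_semifunctor f},
     Dom = src, Cod = tgt, Idt = id_emap, Cmp = comp_emap\<rparr>"

definition topcat_cat ::
  "'u set set \<Rightarrow> 'u topology set \<Rightarrow> ('u topcat, ('u, 'u topcat) emap) cat" where
  "topcat_cat U T = \<lparr>
     Ob = {X. is_topcat U T X},
     Ar = {f. is_topcat U T (src f) \<and> is_topcat U T (tgt f) \<and> is_semifunctor f \<and>
       (\<forall>a \<in> states (src f). mmap f a a (ident (src f) a) = ident (tgt f) (omap f a))},
     Dom = src, Cod = tgt, Idt = id_emap, Cmp = comp_emap\<rparr>"

definition forget_ident :: "('u topcat, ('u, 'u topcat) emap, 'u flow, ('u, 'u flow) emap) ftr" where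
  "forget_ident = \<lparr>onOb = flow.truncate,
     onAr = (\<lambda>f. \<lparr>src = flow.truncate (src f), tgt = flow.truncate (tgt f),
       omap = omap f, mmap = mmap f\<rparr>)\<rparr>"

text \<open>\<open>I\<^sup>+\<close>, the left adjoint of the inclusion of enriched categories into flows, on sets of maps of
  flows.\<close>

definition I_plus ::
  "'u set set \<Rightarrow> 'u topology set \<Rightarrow> ('u, 'u flow) emap set \<Rightarrow> ('u, 'u topcat) emap set" where
  "I_plus U T K = left_adjoint_values (flow_cat U T) (topcat_cat U T) forget_ident K"

definition Glob :: "'u \<Rightarrow> 'u \<Rightarrow> 'u topology \<Rightarrow> 'u flow" where
  "Glob a b Z = \<lparr>states = {a, b},
     paths = (\<lambda>c d. if c = a \<and> d = b then Z else discrete_topology {}),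
     pcomp = (\<lambda>_ _ _ _ _. undefined)\<rparr>"

definition set_flow :: "'u set \<Rightarrow> 'u flow" where
  "set_flow A = \<lparr>states = A, paths = (\<lambda>_ _. discrete_topology {}),
     pcomp = (\<lambda>_ _ _ _ _. undefined)\<rparr>"

definition flow_inclusion :: "'u flow \<Rightarrow> 'u flow \<Rightarrow> ('u, 'u flow) emap" where
  "flow_inclusion X Y = \<lparr>src = X, tgt = Y, omap = restrict id (states X),
     mmap = (\<lambda>a b. restrict id (carr X a b))\<rparr>"

text \<open>The type \<open>'u\<close> has no distinguished disks and no distinguished elements \<open>0\<close> and \<open>1\<close>: all copies of
  each generating map are taken. They are isomorphic to each other, so that the right lifting
  property is not affected.\<close>

definition I_gl :: "('u, 'u flow) emap set" where
  "I_gl = {flow_inclusion (Glob a b (subtopology D (k ` topspace (sphere_bd n)))) (Glob a b D) |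
     a b n D k. a \<noteq> b \<and> homeomorphic_map (disk n) D k}"

definition C_map :: "('u, 'u flow) emap set" where
  "C_map = {flow_inclusion (set_flow {}) (set_flow {a}) | a. True}"

definition R_map :: "('u, 'u flow) emap set" where
  "R_map = {\<lparr>src = set_flow {a, b}, tgt = set_flow {a}, omap = restrict (\<lambda>_. a) {a, b},
     mmap = (\<lambda>_ _ _. undefined)\<rparr> | a b. a \<noteq> b}"


section \<open>The two model structures\<close>

text \<open>A combinatorial model structure is a cofibrantly generated one on a locally presentable
  category; the latter is a property of the category and not of the model structure, and makes all
  objects small.\<close>

definition cofibrantly_generated :: "'u set set \<Rightarrow> ('o, 'a) cat \<Rightarrow> 'a model \<Rightarrow> bool" where
  "cofibrantly_generated U C M \<longleftrightarrow> model_structure C M \<and>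
     (\<exists>K. small U K \<and> generating_cofibrations C M K) \<and>
     (\<exists>K. small U K \<and> generating_trivial_cofibrations C M K)"

definition q_weak_equivalences ::
  "'u set set \<Rightarrow> 'u topology set \<Rightarrow> ('u, 'u topcat) emap set" where
  "q_weak_equivalences U T = {f \<in> Ar (topcat_cat U T).
     bij_betw (omap f) (states (src f)) (states (tgt f)) \<and>
     (\<forall>a \<in> states (src f). \<forall>b \<in> states (src f).
        weak_homotopy_equivalence (paths (src f) a b) (paths (tgt f) (omap f a) (omap f b))
          (mmap f a b))}"

definition q_fibrations ::
  "'u set set \<Rightarrow> 'u topology set \<Rightarrow> ('u, 'u topcat) emap set" where
  "q_fibrations U T = {f \<in> Ar (topcat_cat U T).
     \<forall>a \<in> states (src f). \<forall>b \<in> states (src f).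
       serre_fibration (paths (src f) a b) (paths (tgt f) (omap f a) (omap f b)) (mmap f a b)}"

text \<open>An arrow of \<open>pi1_cat X\<close> is a path component together with its two end objects.\<close>

definition pi1_cat :: "'u topcat \<Rightarrow> ('u, 'u \<times> 'u \<times> 'u set) cat" where
  "pi1_cat X = \<lparr>
     Ob = states X,
     Ar = {(a, b, u). a \<in> states X \<and> b \<in> states X \<and> u \<in> path_components_of (paths X a b)},
     Dom = (\<lambda>(a, b, u). a),
     Cod = (\<lambda>(a, b, u). b),
     Idt = (\<lambda>a. (a, a, path_component_of_set (paths X a a) (ident X a))),
     Cmp = (\<lambda>(b', c, v) (a, b, u). (a, c,
       {z. \<exists>x \<in> u. \<exists>y \<in> v. path_component_of (paths X a c) (pcomp X a b c x y) z}))\<rparr>"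

definition pi1_ftr ::
  "('u, 'u topcat) emap \<Rightarrow> ('u, 'u \<times> 'u \<times> 'u set, 'u, 'u \<times> 'u \<times> 'u set) ftr" where
  "pi1_ftr f = \<lparr>onOb = omap f,
     onAr = (\<lambda>(a, b, u). (omap f a, omap f b,
       {y. \<exists>x \<in> u. path_component_of (paths (tgt f) (omap f a) (omap f b)) (mmap f a b x) y}))\<rparr>"

definition DK_equivalences ::
  "'u set set \<Rightarrow> 'u topology set \<Rightarrow> ('u, 'u topcat) emap set" where
  "DK_equivalences U T = {f \<in> Ar (topcat_cat U T).
     equivalence_of_categories (pi1_cat (src f)) (pi1_cat (tgt f)) (pi1_ftr f) \<and>
     (\<forall>a \<in> states (src f). \<forall>b \<in> states (src f).
        weak_homotopy_equivalence (paths (src f) a b) (paths (tgt f) (omap f a) (omap f b))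
          (mmap f a b))}"

definition is_q_model_structure ::
  "'u set set \<Rightarrow> 'u topology set \<Rightarrow> ('u, 'u topcat) emap model \<Rightarrow> bool" where
  "is_q_model_structure U T M \<longleftrightarrow> cofibrantly_generated U (topcat_cat U T) M \<and>
     generating_cofibrations (topcat_cat U T) M (I_plus U T (I_gl \<union> C_map \<union> R_map)) \<and>
     Weq M = q_weak_equivalences U T \<and> Fib M = q_fibrations U T"

definition is_Ilias_model_structure ::
  "'u set set \<Rightarrow> 'u topology set \<Rightarrow> ('u, 'u topcat) emap model \<Rightarrow> bool" where
  "is_Ilias_model_structure U T M \<longleftrightarrow> cofibrantly_generated U (topcat_cat U T) M \<and>
     generating_cofibrations (topcat_cat U T) M (I_plus U T (I_gl \<union> C_map)) \<and>
     Weq M = DK_equivalences U T"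

end

theory Submission
  imports Defs
begin

text \<open>Let \<open>E\<close> be the category with two uniquely isomorphic objects. The functor \<open>E \<rightarrow> pt\<close>
  is a trivial fibration for the Ilias structure, because the maps in \<open>I\<^sup>+(I\<^sup>g\<^sup>l \<union> {C})\<close> are injective on
  objects, and it is not bijective on objects. Its section \<open>pt \<rightarrow> E\<close> is a DK-equivalence and a
  q-fibration, but it is not surjective on objects, hence (by lifting against \<open>I\<^sup>+(C)\<close>) not a trivial
  fibration for the Ilias structure. This settles the right Quillen conditions. For the left ones,
  factor \<open>pt \<rightarrow> E\<close> as a trivial cofibration followed by a fibration in the Ilias structure, the latter
  being surjective on objects by two-out-of-three; and factor the fold map from two points to one as a
  cofibration followed by a trivial fibration in the q-structure, where the cofibration then
  identifies the two points and has no lifting against \<open>E \<rightarrow> pt\<close>.\<close>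

section \<open>Consequences of the axioms of categories and model structures\<close>

lemma category_ident:
  assumes "is_category C" "a \<in> Ob C"
  shows "Idt C a \<in> homs C a a"
proof -
  have "\<forall>a \<in> Ob C. Idt C a \<in> homs C a a"
    using assms(1) unfolding is_category_def by (elim conjE)
  then show ?thesis using assms(2) by blast
qed

lemma category_comp:
  assumes "is_category C" "f \<in> homs C a b" "g \<in> homs C b c"
  shows "Cmp C g f \<in> homs C a c"
proof -
  have "\<forall>f \<in> Ar C. \<forall>g \<in> Ar C. Cod C f = Dom C g \<longrightarrow> Cmp C g f \<in> homs C (Dom C f) (Cod C g)"
    using assms(1) unfolding is_category_def by (elim conjE)
  then show ?thesis using assms(2,3) by (auto simp: homs_def)
qed

lemma category_left_unit:
  assumes "is_category C" "f \<in> homs C a b"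
  shows "Cmp C (Idt C b) f = f"
proof -
  have "\<forall>f \<in> Ar C. Cmp C f (Idt C (Dom C f)) = f \<and> Cmp C (Idt C (Cod C f)) f = f"
    using assms(1) unfolding is_category_def by (elim conjE)
  then show ?thesis
    using assms(2) by (auto simp: homs_def)
qed

lemma model_two_of_three:
  assumes "model_structure C M" "f \<in> homs C a b" "g \<in> homs C b c"
  shows "f \<in> Weq M \<Longrightarrow> Cmp C g f \<in> Weq M \<Longrightarrow> g \<in> Weq M"
    and "g \<in> Weq M \<Longrightarrow> Cmp C g f \<in> Weq M \<Longrightarrow> f \<in> Weq M"
proof -
  have "\<forall>f \<in> Ar C. \<forall>g \<in> Ar C. Cod C f = Dom C g \<longrightarrow>
      (f \<in> Weq M \<and> g \<in> Weq M \<longrightarrow> Cmp C g f \<in> Weq M) \<and>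
      (f \<in> Weq M \<and> Cmp C g f \<in> Weq M \<longrightarrow> g \<in> Weq M) \<and>
      (g \<in> Weq M \<and> Cmp C g f \<in> Weq M \<longrightarrow> f \<in> Weq M)"
    using assms(1) unfolding model_structure_def by (elim conjE)
  then show "f \<in> Weq M \<Longrightarrow> Cmp C g f \<in> Weq M \<Longrightarrow> g \<in> Weq M"
    and "g \<in> Weq M \<Longrightarrow> Cmp C g f \<in> Weq M \<Longrightarrow> f \<in> Weq M"
    using assms(2,3) by (auto simp: homs_def)
qed

lemma model_arrows:
  assumes "model_structure C M"
  shows "Cof M \<subseteq> Ar C" "Fib M \<subseteq> Ar C"
proof -
  have "Cof M \<subseteq> Ar C \<and> Fib M \<subseteq> Ar C"
    using assms unfolding model_structure_def by (elim conjE) (intro conjI)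
  then show "Cof M \<subseteq> Ar C" "Fib M \<subseteq> Ar C" by blast+
qed

lemma model_lifting:
  assumes "model_structure C M" "i \<in> Cof M" "f \<in> Fib M \<inter> Weq M"
  shows "has_lifting C i f"
proof -
  have "\<forall>i \<in> Cof M. \<forall>p \<in> Fib M. i \<in> Weq M \<or> p \<in> Weq M \<longrightarrow> has_lifting C i p"
    using assms(1) unfolding model_structure_def by (elim conjE)
  then show ?thesis using assms(2,3) by blast
qed

lemma model_factorization_trivial_cofibration:
  assumes "model_structure C M" "f \<in> Ar C"
  obtains i g where "i \<in> Cof M \<inter> Weq M" "g \<in> Fib M"
      "Cod C i = Dom C g" "Cmp C g i = f"
proof -
  have "\<forall>f \<in> Ar C. \<exists>i \<in> Cof M \<inter> Weq M. \<exists>p \<in> Fib M. Cod C i = Dom C p \<and> Cmp C p i = f"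
    using assms(1) unfolding model_structure_def by (elim conjE)
  then show ?thesis using assms(2) that by blast
qed

lemma model_factorization_trivial_fibration:
  assumes "model_structure C M" "f \<in> Ar C"
  obtains i g where "i \<in> Cof M" "g \<in> Fib M \<inter> Weq M" "Cod C i = Dom C g" "Cmp C g i = f"
proof -
  have "\<forall>f \<in> Ar C. \<exists>i \<in> Cof M. \<exists>p \<in> Fib M \<inter> Weq M. Cod C i = Dom C p \<and> Cmp C p i = f"
    using assms(1) unfolding model_structure_def by (elim conjE)
  then show ?thesis using assms(2) that by blast
qed

section \<open>Small sets and one-point spaces\<close>

text \<open>Closure under subsets of images, applied to the identity of a two-element small set. The
  two elements become the objects of all test categories.\<close>

lemma universe_small_sets:
  assumes "universe U"
  obtains p q :: 'u where "p \<noteq> q" "\<And>S. S \<subseteq> {p, q} \<Longrightarrow> S \<in> U"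
proof -
  note universe = assms[unfolded universe_def]
  obtain a b where ab: "a \<noteq> b" "{a, b} \<in> U"
    using conjunct1[OF universe] by blast
  note image = conjunct1[OF conjunct2[OF universe]]
  have "S \<in> U" if "S \<subseteq> {a, b}" for S
    using image[rule_format, OF ab(2), of S id] that by simp
  with ab(1) show ?thesis by (rule that)
qed

text \<open>Every preimage is either empty or the whole space.\<close>

lemma continuous_map_into_subsingleton:
  assumes "h \<in> topspace W \<rightarrow> A" "A \<subseteq> {c}"
  shows "continuous_map W (discrete_topology A) h"
proof -
  have "{x \<in> topspace W. h x \<in> V} = (if c \<in> V then topspace W else {})" for V
    using assms by auto
  then show ?thesis
    using assms(1) by (simp add: continuous_map_def)
qed

lemma CW_complex_empty: "CW_complex (discrete_topology {})"
  unfolding CW_complex_def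
  by (intro conjI exI[of _ "{}"]) auto

lemma topspace_disk_0: "topspace (disk 0) = {\<lambda>_. 0}"
  by (auto simp: disk_def topspace_Euclidean_space)

lemma topspace_sphere_bd_0: "topspace (sphere_bd 0) = {}"
  by (auto simp: sphere_bd_def)

text \<open>One cell of dimension 0, whose boundary is empty. Together with the empty complex, this
  places the morphism spaces of the test categories in \<open>T\<close>.\<close>

lemma CW_complex_point: "CW_complex (discrete_topology {z})"
proof -
  have cell: "open_cell 0 = {\<lambda>_. 0}"
    by (simp add: open_cell_def topspace_disk_0 topspace_sphere_bd_0)
  show ?thesis
    unfolding CW_complex_def
    by (intro conjI exI[of _ "{(0, \<lambda>_. z)}"])
      (auto simp: cell topspace_sphere_bd_0 topspace_disk_0 intro!: exI[of _ "{}"])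
qed

text \<open>Any homotopy in the base is constant at \<open>w\<close>, so the homotopy constant at
  \<open>z\<close> lifts it.\<close>

lemma serre_fibration_point:
  assumes "f z = w"
  shows "serre_fibration (discrete_topology {z}) (discrete_topology {w}) f"
proof -
  have "f z = H (t, s)"
    if "continuous_map (prod_topology (disk n) (top_of_set {0..1::real})) (discrete_topology {w}) H"
      "t \<in> topspace (disk n)" "s \<in> {0..1}" for n H t s
    using continuous_map_image_subset_topspace[OF that(1)] that(2,3) assms by force
  moreover have "g t = z" if "continuous_map (disk n) (discrete_topology {z}) g"
    "t \<in> topspace (disk n)" for n g t
    using continuous_map_image_subset_topspace[OF that(1)] that(2) by force
  moreover have "continuous_map (discrete_topology {z}) (discrete_topology {w}) f"
    using assms by (intro continuous_map_into_subsingleton[of _ _ _ w]) auto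
  moreover have "continuous_map X (discrete_topology {z}) (\<lambda>_. z)" for X :: "((nat \<Rightarrow> real) \<times> real) topology"
    by simp
  ultimately show ?thesis
    unfolding serre_fibration_def by metis
qed

section \<open>Enriched categories with at most one morphism between any two objects\<close>

text \<open>A preorder seen as an enriched category. The same element \<open>z\<close> is the
  morphism between any two related objects, which turns composition and identities into
  constants.\<close>

definition thin :: "('u \<Rightarrow> 'u \<Rightarrow> bool) \<Rightarrow> 'u \<Rightarrow> 'u set \<Rightarrow> 'u topcat" where
  "thin r z S = \<lparr>states = S, paths = (\<lambda>a b. discrete_topology (if r a b then {z} else {})),
     pcomp = (\<lambda>_ _ _ _ _. z), ident = (\<lambda>_. z)\<rparr>"

text \<open>The maps constructed below are constant on morphisms. Restriction to the carriers makes
  them extensional, as arrows must be; the record scheme covers both flows and enriched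
  categories.\<close>

definition flat_emap ::
  "('u, 'z) flow_scheme \<Rightarrow> ('u, 'z) flow_scheme \<Rightarrow> ('u \<Rightarrow> 'u) \<Rightarrow> 'u \<Rightarrow>
    ('u, ('u, 'z) flow_scheme) emap" where
  "flat_emap X Y \<phi> c = \<lparr>src = X, tgt = Y, omap = restrict \<phi> (states X),
     mmap = (\<lambda>a b. restrict (\<lambda>_. c) (carr X a b))\<rparr>"

lemma thin_simps [simp]:
  "states (thin r z S) = S"
  "topspace (paths (thin r z S) a b) = (if r a b then {z} else {})"
  "pcomp (thin r z S) a b c x y = z"
  "ident (thin r z S) a = z"
  by (simp_all add: thin_def)

lemma flat_emap_simps [simp]:
  "src (flat_emap X Y \<phi> c) = X" "tgt (flat_emap X Y \<phi> c) = Y"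
  "omap (flat_emap X Y \<phi> c) = restrict \<phi> (states X)"
  "mmap (flat_emap X Y \<phi> c) a b = restrict (\<lambda>_. c) (carr X a b)"
  by (simp_all add: flat_emap_def)

lemma truncate_simps [simp]:
  "states (flow.truncate X) = states X" "paths (flow.truncate X) = paths X"
  "pcomp (flow.truncate X) = pcomp X"
  by (simp_all add: flow.truncate_def)

lemma carr_truncate [simp]: "carr (flow.truncate X) = carr X"
  by (intro ext) (simp add: carr_def)

lemma forget_ident_simps [simp]:
  "onOb forget_ident = flow.truncate"
  "src (onAr forget_ident f) = flow.truncate (src f)"
  "tgt (onAr forget_ident f) = flow.truncate (tgt f)"
  "omap (onAr forget_ident f) = omap f"
  "mmap (onAr forget_ident f) = mmap f"
  by (simp_all add: forget_ident_def)

lemma comp_emap_simps [simp]: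
  "src (comp_emap g f) = src f" "tgt (comp_emap g f) = tgt g"
  "omap (comp_emap g f) = compose (states (src f)) (omap g) (omap f)"
  "mmap (comp_emap g f) a b = compose (carr (src f) a b) (mmap g (omap f a) (omap f b)) (mmap f a b)"
  by (simp_all add: comp_emap_def)

lemma topcat_cat_simps [simp]:
  "Ob (topcat_cat U T) = {X. is_topcat U T X}"
  "Dom (topcat_cat U T) = src" "Cod (topcat_cat U T) = tgt"
  "Idt (topcat_cat U T) = id_emap" "Cmp (topcat_cat U T) = comp_emap"
  by (simp_all add: topcat_cat_def)

lemma flow_cat_simps [simp]:
  "Ob (flow_cat U T) = {X. is_flow U T X}"
  "Dom (flow_cat U T) = src" "Cod (flow_cat U T) = tgt"
  "Idt (flow_cat U T) = id_emap" "Cmp (flow_cat U T) = comp_emap"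
  by (simp_all add: flow_cat_def)

lemma topcat_arrow_iff:
  "f \<in> Ar (topcat_cat U T) \<longleftrightarrow> is_topcat U T (src f) \<and> is_topcat U T (tgt f) \<and>
     is_semifunctor f \<and> (\<forall>a \<in> states (src f). mmap f a a (ident (src f) a) = ident (tgt f) (omap f a))"
  by (simp add: topcat_cat_def)

lemma flow_arrow_iff:
  "f \<in> Ar (flow_cat U T) \<longleftrightarrow> is_flow U T (src f) \<and> is_flow U T (tgt f) \<and> is_semifunctor f"
  by (simp add: flow_cat_def)

lemma topcat_arrowD:
  assumes "f \<in> Ar (topcat_cat U T)"
  shows "is_topcat U T (src f)" "is_topcat U T (tgt f)" "is_semifunctor f"
    "\<And>a. a \<in> states (src f) \<Longrightarrow> mmap f a a (ident (src f) a) = ident (tgt f) (omap f a)"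
  using assms by (simp_all add: topcat_arrow_iff)

lemma topcat_homs:
  "f \<in> homs (topcat_cat U T) X Y \<longleftrightarrow> f \<in> Ar (topcat_cat U T) \<and> src f = X \<and> tgt f = Y"
  by (simp add: homs_def)

lemma flow_homs:
  "f \<in> homs (flow_cat U T) X Y \<longleftrightarrow> f \<in> Ar (flow_cat U T) \<and> src f = X \<and> tgt f = Y"
  by (simp add: homs_def)

lemma is_flow_truncate: "is_flow U T (flow.truncate X) \<longleftrightarrow> is_flow U T X"
  by (simp add: is_flow_def)

lemma ident_in_carr: "is_topcat U T X \<Longrightarrow> a \<in> states X \<Longrightarrow> ident X a \<in> carr X a a"
  by (simp add: is_topcat_def carr_def)

lemma is_topcat_flow: "is_topcat U T X \<Longrightarrow> is_flow U T X"
  by (simp add: is_topcat_def)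

lemma semifunctor_omap:
  "is_semifunctor f \<Longrightarrow> a \<in> states (src f) \<Longrightarrow> omap f a \<in> states (tgt f)"
  by (auto simp: is_semifunctor_def)

lemma semifunctor_mmap:
  assumes "is_semifunctor f" "a \<in> states (src f)" "b \<in> states (src f)"
  shows "continuous_map (paths (src f) a b) (paths (tgt f) (omap f a) (omap f b)) (mmap f a b)"
  using assms unfolding is_semifunctor_def by (elim conjE) blast

lemma semifunctor_carr:
  assumes "is_semifunctor f" "x \<in> carr (src f) a b"
  shows "mmap f a b x \<in> carr (tgt f) (omap f a) (omap f b)"
proof -
  have "a \<in> states (src f)" "b \<in> states (src f)" "x \<in> topspace (paths (src f) a b)"
    using assms(2) by (auto simp: carr_def split: if_splits)
  then show ?thesis
    using continuous_map_image_subset_topspace[OF semifunctor_mmap[OF assms(1)]]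
      semifunctor_omap[OF assms(1)]
    by (auto simp: carr_def)
qed

lemma emap_eqI:
  fixes f g :: "('u, ('u, 'z) flow_scheme) emap"
  assumes "is_semifunctor f" "is_semifunctor g" "src f = src g" "tgt f = tgt g"
    and ob: "\<And>a. a \<in> states (src f) \<Longrightarrow> omap f a = omap g a"
    and ar: "\<And>a b x. x \<in> carr (src f) a b \<Longrightarrow> mmap f a b x = mmap g a b x"
  shows "f = g"
proof -
  have "omap f = omap g"
    by (rule extensionalityI[of _ "states (src f)"])
      (use assms in \<open>auto simp: is_semifunctor_def PiE_def\<close>)
  moreover have "mmap f a b = mmap g a b" for a b
    by (rule extensionalityI[of _ "carr (src f) a b"])
      (use assms in \<open>auto simp: is_semifunctor_def\<close>)
  hence "mmap f = mmap g" by blast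
  ultimately show ?thesis
    using assms(3,4) by simp
qed

text \<open>Closure is hidden in the continuity of composition: the product space has all pairs as
  its points.\<close>

lemma pcomp_closed:
  assumes "is_flow U T X" "a \<in> states X" "b \<in> states X" "c \<in> states X"
    "x \<in> topspace (paths X a b)" "y \<in> topspace (paths X b c)"
  shows "pcomp X a b c x y \<in> topspace (paths X a c)"
proof -
  obtain P where "is_product T (paths X a b) (paths X b c) P"
    "continuous_map P (paths X a c) (\<lambda>(x, y). pcomp X a b c x y)"
    using assms unfolding is_flow_def continuous_on_product_def by meson
  then have "(x, y) \<in> topspace P" "continuous_map P (paths X a c) (\<lambda>(x, y). pcomp X a b c x y)"
    using assms by (auto simp: is_product_def)
  then show ?thesis
    by (force simp: continuous_map_def)
qed

text \<open>Constant maps are continuous, and compatibility with composition reduces to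
  \<open>c\<close> being idempotent. Only nonempty spaces of execution paths impose a
  condition.\<close>

lemma flat_emap_semifunctor:
  assumes X: "is_flow U T X" and "\<phi> \<in> states X \<rightarrow> states Y"
    and ar: "\<And>a b. a \<in> states X \<Longrightarrow> b \<in> states X \<Longrightarrow> topspace (paths X a b) \<noteq> {} \<Longrightarrow>
      c \<in> topspace (paths Y (\<phi> a) (\<phi> b))"
    and idem: "\<And>x y z. x \<in> states X \<Longrightarrow> y \<in> states X \<Longrightarrow> z \<in> states X \<Longrightarrow>
      topspace (paths X x y) \<noteq> {} \<Longrightarrow> topspace (paths X y z) \<noteq> {} \<Longrightarrow>
      pcomp Y (\<phi> x) (\<phi> y) (\<phi> z) c c = c"
  shows "is_semifunctor (flat_emap X Y \<phi> c)"
proof -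
  have "continuous_map (paths X a b) (paths Y (\<phi> a) (\<phi> b)) (restrict (\<lambda>_. c) (carr X a b))"
    if "a \<in> states X" "b \<in> states X" for a b
  proof (rule continuous_map_eq)
    show "continuous_map (paths X a b) (paths Y (\<phi> a) (\<phi> b)) (\<lambda>_. c)"
      using ar[OF that] by auto
    show "c = restrict (\<lambda>_. c) (carr X a b) x" if "x \<in> topspace (paths X a b)" for x
      using that \<open>a \<in> _\<close> \<open>b \<in> _\<close> by (simp add: carr_def)
  qed
  note cont = this
  have ob: "omap (flat_emap X Y \<phi> c) x = \<phi> x" if "x \<in> states X" for x
    using that by simp
  have ar: "mmap (flat_emap X Y \<phi> c) x y u = c"
    if "x \<in> states X" "y \<in> states X" "u \<in> topspace (paths X x y)" for x y u
    using that by (simp add: carr_def)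
  have comp: "mmap (flat_emap X Y \<phi> c) x z (pcomp X x y z u v) =
      pcomp Y (\<phi> x) (\<phi> y) (\<phi> z)
        (mmap (flat_emap X Y \<phi> c) x y u) (mmap (flat_emap X Y \<phi> c) y z v)"
    if "x \<in> states X" "y \<in> states X" "z \<in> states X"
      "u \<in> topspace (paths X x y)" "v \<in> topspace (paths X y z)" for x y z u v
  proof -
    have "pcomp Y (\<phi> x) (\<phi> y) (\<phi> z) c c = c"
      using that by (intro idem) auto
    then show ?thesis
      using ar[OF that(1,2,4)] ar[OF that(2,3,5)] ar[OF that(1,3) pcomp_closed[OF X that]] by simp
  qed
  show ?thesis
    unfolding is_semifunctor_def flat_emap_simps(1,2)
  proof (intro conjI ballI allI)
    show "omap (flat_emap X Y \<phi> c) \<in> states X \<rightarrow>\<^sub>E states Y"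
      using assms(2) by auto
    show "mmap (flat_emap X Y \<phi> c) a b \<in> extensional (carr X a b)" for a b by simp
  qed (simp_all only: ob comp, use cont in simp)
qed

text \<open>On morphisms both maps take values in one and the same subset of
  \<open>{z}\<close>.\<close>

lemma thin_arrow_eqI:
  fixes f g :: "('u, ('u, 'z) flow_scheme) emap"
  assumes "is_semifunctor f" "is_semifunctor g" "src f = src g" "tgt f = tgt g"
    and thin: "\<And>a b. topspace (paths (tgt f) a b) \<subseteq> {z}"
    and ob: "\<And>a. a \<in> states (src f) \<Longrightarrow> omap f a = omap g a"
  shows "f = g"
proof (rule emap_eqI[OF assms(1-4) ob])
  fix a b x assume x: "x \<in> carr (src f) a b"
  have "carr (tgt f) c d \<subseteq> {z}" for c d
    using thin[of c d] by (simp add: carr_def)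
  moreover have "mmap f a b x \<in> carr (tgt f) (omap f a) (omap f b)"
    by (rule semifunctor_carr[OF assms(1) x])
  moreover have "mmap g a b x \<in> carr (tgt f) (omap g a) (omap g b)"
    using semifunctor_carr[OF assms(2), of x a b] x assms(3,4) by simp
  ultimately show "mmap f a b x = mmap g a b x" by blast
qed

section \<open>Trivial fibrations and DK-equivalences between thin categories\<close>

locale two_model_structures =
  fixes U :: "'u set set" and T :: "'u topology set"
    and Mq MDK :: "('u, 'u topcat) emap model" and p q :: 'u
  assumes convenient: "convenient_category U T"
    and q_model: "is_q_model_structure U T Mq" and DK_model: "is_Ilias_model_structure U T MDK"
    and distinct: "p \<noteq> q" and small_sets: "\<And>S. S \<subseteq> {p, q} \<Longrightarrow> S \<in> U"
begin

abbreviation "cat \<equiv> topcat_cat U T"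
text \<open>Equality as the preorder leaves only identities, so \<open>pt\<close> is the terminal
  category, \<open>empt\<close> the initial one and \<open>disc2\<close> a pair of isolated objects.
  The total relation makes \<open>indisc2\<close> the category \<open>E\<close> of two uniquely
  isomorphic objects.\<close>

abbreviation "pt \<equiv> thin (=) p {p}"
abbreviation "empt \<equiv> thin (=) p {}"
abbreviation "disc2 \<equiv> thin (=) p {p, q}"
abbreviation "indisc2 \<equiv> thin (\<lambda>_ _. True) p {p, q}"

section \<open>The test categories as objects of \<open>cat\<close>\<close>

lemma discrete_in_T:
  assumes "A \<subseteq> {p}"
  shows "discrete_topology A \<in> T"
proof -
  have "\<forall>X. CW_complex X \<and> topspace X \<in> U \<longrightarrow> X \<in> T"
    using convenient unfolding convenient_category_def by (elim conjE)
  moreover have "CW_complex (discrete_topology A)"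
    using assms CW_complex_empty CW_complex_point by (metis subset_singletonD)
  moreover have "A \<in> U" using assms by (intro small_sets) blast
  ultimately show ?thesis by (metis topspace_discrete_topology)
qed

text \<open>The set of pairs has at most one element, so its discrete topology is the product: every
  map into it is continuous.\<close>

lemma continuous_on_product_point:
  assumes "A \<subseteq> {p}" "B \<subseteq> {p}" "c \<in> topspace Z \<or> A = {} \<or> B = {}"
  shows "continuous_on_product T (discrete_topology A) (discrete_topology B) Z (\<lambda>_ _. c)"
  unfolding continuous_on_product_def
proof (intro exI conjI)
  let ?P = "discrete_topology (A \<times> B)"
  \<comment> \<open>The member of \<open>T\<close> that represents the product is the image of
    \<open>fst\<close> and not \<open>A\<close>, because the product is empty whenever
    \<open>B\<close> is.\<close>
  have "homeomorphic_maps ?P (discrete_topology (fst ` (A \<times> B))) fst (\<lambda>x. (x, p))"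
    using assms(1,2) by (auto simp: homeomorphic_maps_def)
  then have "?P homeomorphic_space discrete_topology (fst ` (A \<times> B))"
    by (rule homeomorphic_maps_imp_homeomorphic_space)
  moreover have "discrete_topology (fst ` (A \<times> B)) \<in> T"
    using assms(1) by (intro discrete_in_T) auto
  moreover have "continuous_map W ?P (\<lambda>w. (f w, g w))"
    if "continuous_map W (discrete_topology A) f" "continuous_map W (discrete_topology B) g" for W f g
    using that assms(1,2)
    by (intro continuous_map_into_subsingleton[of _ _ _ "(p, p)"]) (auto simp: continuous_map_def)
  ultimately show "is_product T (discrete_topology A) (discrete_topology B) ?P"
    by (auto simp: is_product_def)
  show "continuous_map ?P Z (\<lambda>(x, y). c)"
    using assms(3) by (auto simp: case_prod_unfold)
qed

text \<open>Reflexivity provides the identities and transitivity the composites; all equations hold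
  because every morphism is \<open>p\<close>.\<close>

lemma thin_topcat:
  assumes "reflp r" "transp r" "S \<subseteq> {p, q}"
  shows "is_topcat U T (thin r p S)"
proof -
  have "continuous_on_product T (paths (thin r p S) a b) (paths (thin r p S) b c)
      (paths (thin r p S) a c) (pcomp (thin r p S) a b c)" for a b c
  proof -
    have "continuous_on_product T (discrete_topology (if r a b then {p} else {}))
       (discrete_topology (if r b c then {p} else {}))
       (discrete_topology (if r a c then {p} else {})) (\<lambda>_ _. p)"
      by (rule continuous_on_product_point) (use \<open>transp r\<close> in \<open>auto dest: transpD\<close>)
    then show ?thesis by (simp add: thin_def)
  qed
  moreover have "paths (thin r p S) a b \<in> T" for a b
    using discrete_in_T by (simp add: thin_def)
  ultimately show ?thesis
    using assms small_sets by (simp add: is_topcat_def is_flow_def reflpD)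
qed

lemma thin_topcats [simp]:
  "is_topcat U T pt" "is_topcat U T empt" "is_topcat U T disc2" "is_topcat U T indisc2"
  using distinct by (auto intro!: thin_topcat reflpI transpI)

lemma functor_to_thin:
  assumes "is_topcat U T X" "is_topcat U T (thin r p S)" "\<phi> \<in> states X \<rightarrow> S"
    and "\<And>a b. a \<in> states X \<Longrightarrow> b \<in> states X \<Longrightarrow> topspace (paths X a b) \<noteq> {} \<Longrightarrow> r (\<phi> a) (\<phi> b)"
  shows "flat_emap X (thin r p S) \<phi> p \<in> homs cat X (thin r p S)"
proof -
  have "is_semifunctor (flat_emap X (thin r p S) \<phi> p)"
    by (rule flat_emap_semifunctor[OF is_topcat_flow[OF assms(1)]]) (use assms in auto)
  then show ?thesis
    using assms(1,2) ident_in_carr[OF assms(1)] by (simp add: topcat_homs topcat_arrow_iff)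
qed

lemma functor_to_indisc2:
  assumes "is_topcat U T X" "\<phi> \<in> states X \<rightarrow> {p, q}"
  shows "flat_emap X indisc2 \<phi> p \<in> homs cat X indisc2"
  by (rule functor_to_thin) (use assms in auto)

section \<open>Objects of the enriched category generated by a flow\<close>

lemma universal_arrow_iff:
  "universal_arrow (flow_cat U T) cat forget_ident A X e \<longleftrightarrow>
     is_topcat U T X \<and> e \<in> homs (flow_cat U T) A (flow.truncate X) \<and>
     (\<forall>Y f. is_topcat U T Y \<and> f \<in> homs (flow_cat U T) A (flow.truncate Y) \<longrightarrow>
       (\<exists>!h. h \<in> homs cat X Y \<and> comp_emap (onAr forget_ident h) e = f))"
  unfolding universal_arrow_def topcat_cat_simps flow_cat_simps forget_ident_simps by blast

lemma universal_arrowD: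
  assumes "universal_arrow (flow_cat U T) cat forget_ident A X e"
  shows "is_topcat U T X" "is_flow U T A" "is_semifunctor e" "src e = A" "tgt e = flow.truncate X"
    "\<And>Y f. is_topcat U T Y \<Longrightarrow> f \<in> homs (flow_cat U T) A (flow.truncate Y) \<Longrightarrow>
      \<exists>!h. h \<in> homs cat X Y \<and> comp_emap (onAr forget_ident h) e = f"
proof -
  have "e \<in> homs (flow_cat U T) A (flow.truncate X)"
    using assms unfolding universal_arrow_iff by blast
  then have e: "e \<in> Ar (flow_cat U T)" "src e = A" "tgt e = flow.truncate X"
    by (simp_all add: flow_homs)
  then show "src e = A" "tgt e = flow.truncate X" by blast+
  show "is_flow U T A" "is_semifunctor e"
    using e(1,2) by (simp_all add: flow_arrow_iff)
qed (use assms in \<open>unfold universal_arrow_iff, blast+\<close>)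

text \<open>Functors to \<^term>\<open>indisc2\<close> are arbitrary functions on objects, and so detect whether the unit
  of \<open>I\<^sup>+\<close> is surjective or injective on objects.\<close>

lemma universal_arrow_surj:
  assumes "universal_arrow (flow_cat U T) cat forget_ident A X e"
  shows "omap e ` states A = states X"
proof -
  note X = universal_arrowD(1)[OF assms] and e = universal_arrowD(3,4,5,2)[OF assms]
    and uni = universal_arrowD(6)[OF assms]
  have "x \<in> omap e ` states A" if x: "x \<in> states X" for x
  proof (rule ccontr)
    assume nx: "x \<notin> omap e ` states A"
    let ?h = "\<lambda>\<phi>. flat_emap X indisc2 \<phi> p"
    let ?f = "flat_emap A (flow.truncate indisc2) (\<lambda>_. p) p"
    have f: "is_semifunctor ?f"
      by (rule flat_emap_semifunctor[OF e(4)]) auto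
    then have "?f \<in> homs (flow_cat U T) A (flow.truncate indisc2)"
      using e(4) is_topcat_flow[OF thin_topcats(4)]
      by (simp add: flow_homs flow_arrow_iff is_flow_truncate)
    then have uniq: "\<exists>!h. h \<in> homs cat X indisc2 \<and> comp_emap (onAr forget_ident h) e = ?f"
      by (rule uni[OF thin_topcats(4)])
    have carr: "mmap e a b y \<in> carr X (omap e a) (omap e b)" if "y \<in> carr A a b" for a b y
      using semifunctor_carr[OF e(1), of y a b] that e(2,3) by simp
    have comp: "comp_emap (onAr forget_ident (?h \<phi>)) e = ?f"
      if "\<And>a. a \<in> omap e ` states A \<Longrightarrow> \<phi> a = p" for \<phi>
      using that e semifunctor_omap[OF e(1)] carr
      by (intro emap.equality ext) (auto simp: compose_def restrict_def)
    have h: "?h \<phi> \<in> homs cat X indisc2" if "\<phi> \<in> UNIV \<rightarrow> {p, q}" for \<phi>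
      by (rule functor_to_indisc2[OF X]) (use that in auto)
    \<comment> \<open>The two functors differ only at \<open>x\<close>, outside the image of
      \<open>e\<close>, so both restrict to \<open>?f\<close> and uniqueness identifies
      them.\<close>
    have "?h (\<lambda>_. p) = ?h (\<lambda>a. if a = x then q else p)"
    proof (rule ex1E[OF uniq])
      fix g assume "\<forall>h. h \<in> homs cat X indisc2 \<and> comp_emap (onAr forget_ident h) e = ?f \<longrightarrow> h = g"
      then have g: "h = g" if "h \<in> homs cat X indisc2" "comp_emap (onAr forget_ident h) e = ?f" for h
        using that by blast
      have "?h (\<lambda>_. p) = g"
        by (rule g[OF h comp]) auto
      moreover have "?h (\<lambda>a. if a = x then q else p) = g"
        by (rule g[OF h comp]) (use nx in auto)
      ultimately show ?thesis by simp
    qed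
    then have "omap (?h (\<lambda>_. p)) x = omap (?h (\<lambda>a. if a = x then q else p)) x" by simp
    then show False using x distinct by simp
  qed
  then show ?thesis
    using semifunctor_omap[OF e(1)] e(2,3) by auto
qed

lemma universal_arrow_inj:
  assumes "universal_arrow (flow_cat U T) cat forget_ident A X e"
  shows "inj_on (omap e) (states A)"
proof (rule inj_onI, rule ccontr)
  fix a b assume ab: "a \<in> states A" "b \<in> states A" "omap e a = omap e b" "a \<noteq> b"
  note A = universal_arrowD(2)[OF assms] and e = universal_arrowD(4)[OF assms]
  \<comment> \<open>This map separates \<open>a\<close> from \<open>b\<close> and factors through
    the unit, which was assumed to identify them.\<close>
  let ?f = "flat_emap A (flow.truncate indisc2) (\<lambda>x. if x = a then q else p) p"
  have f: "is_semifunctor ?f"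
    by (rule flat_emap_semifunctor[OF A]) auto
  then have "?f \<in> homs (flow_cat U T) A (flow.truncate indisc2)"
    using A is_topcat_flow[OF thin_topcats(4)] by (simp add: flow_homs flow_arrow_iff is_flow_truncate)
  then obtain h where "comp_emap (onAr forget_ident h) e = ?f"
    using universal_arrowD(6)[OF assms thin_topcats(4)] by blast
  then have "omap (comp_emap (onAr forget_ident h) e) a = omap ?f a"
    "omap (comp_emap (onAr forget_ident h) e) b = omap ?f b" by auto
  then show False
    using ab e distinct by (simp add: compose_def)
qed

text \<open>The units are bijective on objects, so the naturality square identifies the object map
  of \<open>i\<close> with the state map of \<open>k\<close>.\<close>

lemma I_plus_inj:
  assumes "i \<in> I_plus U T K" and K: "\<And>k. k \<in> K \<Longrightarrow> inj_on (omap k) (states (src k))"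
  shows "inj_on (omap i) (states (src i))"
proof -
  obtain k e e' where k: "k \<in> K" "k \<in> Ar (flow_cat U T)" and
    e: "universal_arrow (flow_cat U T) cat forget_ident (src k) (src i) e" and
    e': "universal_arrow (flow_cat U T) cat forget_ident (tgt k) (tgt i) e'" and
    sq: "comp_emap (onAr forget_ident i) e = comp_emap e' k"
    using assms(1) unfolding I_plus_def left_adjoint_values_def topcat_cat_simps flow_cat_simps
    by blast
  have src: "src e = src k"
    using universal_arrowD(4)[OF e] .
  have *: "omap i (omap e a) = omap e' (omap k a)" if "a \<in> states (src k)" for a
    using arg_cong[OF sq, of "\<lambda>f. omap f a"] that src by (simp add: compose_def)
  show ?thesis
  proof (rule inj_onI)
    fix x y assume "x \<in> states (src i)" "y \<in> states (src i)" and eq: "omap i x = omap i y"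
    then obtain a b where ab: "a \<in> states (src k)" "b \<in> states (src k)" "x = omap e a" "y = omap e b"
      using universal_arrow_surj[OF e] by blast
    then have "omap e' (omap k a) = omap e' (omap k b)"
      using eq * by simp
    then have "omap k a = omap k b"
      using universal_arrow_inj[OF e'] semifunctor_omap[of k] k(2) ab unfolding flow_arrow_iff
      by (auto dest: inj_onD)
    then show "x = y" using K[OF k(1)] ab by (auto dest: inj_onD)
  qed
qed

text \<open>These generators are inclusions. The generator \<open>R\<close> of the q-structure,
  which identifies two states, is not among them.\<close>

lemma generators_inj: "k \<in> I_gl \<union> C_map \<Longrightarrow> inj_on (omap k) (states (src k))"
  by (auto simp: I_gl_def C_map_def flow_inclusion_def Glob_def set_flow_def inj_on_def)

section \<open>The test functors and lifting against \<open>collapse\<close>\<close>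

text \<open>The functor from \<open>E\<close> to the point; \<open>incl\<close> is its
  section.\<close>

definition collapse where "collapse = flat_emap indisc2 pt (\<lambda>_. p) p"

definition incl where "incl = flat_emap pt indisc2 (\<lambda>_. p) p"

definition fold2 where "fold2 = flat_emap disc2 pt (\<lambda>_. p) p"

text \<open>Being injective on objects, this cannot factor through a functor that identifies
  \<open>p\<close> and \<open>q\<close>; it is the top side of the unsolvable lifting
  problem.\<close>

definition split2 where "split2 = flat_emap disc2 indisc2 (\<lambda>x. x) p"

lemma collapse_hom: "collapse \<in> homs cat indisc2 pt"
  unfolding collapse_def by (rule functor_to_thin) auto

lemma incl_hom: "incl \<in> homs cat pt indisc2"
  unfolding incl_def by (rule functor_to_indisc2) auto

lemma fold2_hom: "fold2 \<in> homs cat disc2 pt"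
  unfolding fold2_def by (rule functor_to_thin) auto

lemma split2_hom: "split2 \<in> homs cat disc2 indisc2"
  unfolding split2_def by (rule functor_to_indisc2) auto

lemma q_model_structure: "model_structure cat Mq"
  using q_model by (simp add: is_q_model_structure_def cofibrantly_generated_def)

lemma DK_model_structure: "model_structure cat MDK"
  using DK_model by (simp add: is_Ilias_model_structure_def cofibrantly_generated_def)

text \<open>The category axioms for \<open>cat\<close> are contained in the assumption that
  \<open>Mq\<close> is a model structure on it.\<close>

lemma is_category: "is_category cat"
  using q_model_structure unfolding model_structure_def by (elim conjE)

lemma comp_hom: "f \<in> homs cat X Y \<Longrightarrow> g \<in> homs cat Y Z \<Longrightarrow> comp_emap g f \<in> homs cat X Z"
  using category_comp[OF is_category, of f X Y g Z] by simp

lemma id_hom: "is_topcat U T X \<Longrightarrow> id_emap X \<in> homs cat X X"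
  using category_ident[OF is_category, of X] by simp

lemma hom_arrow: "f \<in> homs cat X Y \<Longrightarrow> f \<in> Ar cat"
  by (simp add: topcat_homs)

lemma homsD:
  assumes "f \<in> homs cat X Y"
  shows "is_semifunctor f" "src f = X" "tgt f = Y"
  using assms topcat_arrowD(3)[of f U T] by (simp_all add: topcat_homs)

lemma hom_omap: "f \<in> homs cat X Y \<Longrightarrow> a \<in> states X \<Longrightarrow> omap f a \<in> states Y"
  using homsD[of f X Y] semifunctor_omap[of f a] by simp

lemma homs_thin_eqI:
  assumes "f \<in> homs cat X (thin r z S)" "g \<in> homs cat X (thin r z S)"
    and "\<And>a. a \<in> states X \<Longrightarrow> omap f a = omap g a"
  shows "f = g"
  by (rule thin_arrow_eqI[OF homsD(1)[OF assms(1)] homsD(1)[OF assms(2)], where z = z])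
    (simp_all add: homsD[OF assms(1)] homsD[OF assms(2)] assms(3))

lemma homs_pt_eq:
  assumes "f \<in> homs cat X pt" "g \<in> homs cat X pt"
  shows "f = g"
  by (rule homs_thin_eqI[OF assms]) (use hom_omap[OF assms(1)] hom_omap[OF assms(2)] in simp)

text \<open>Functors to \<open>indisc2\<close> are arbitrary functions on objects and
  \<open>pt\<close> is terminal, so a lift amounts to extending a function along an
  injection.\<close>

lemma lifting_against_collapse:
  assumes i: "i \<in> Ar cat" "inj_on (omap i) (states (src i))"
  shows "has_lifting cat i collapse"
  unfolding has_lifting_def topcat_cat_simps
proof (intro ballI impI)
  fix u v assume u: "u \<in> homs cat (src i) (src collapse)" and v: "v \<in> homs cat (tgt i) (tgt collapse)"
  have u': "u \<in> homs cat (src i) indisc2" and v': "v \<in> homs cat (tgt i) pt"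
    using u v by (simp_all add: collapse_def)
  \<comment> \<open>On the image of \<open>i\<close> the value is forced by \<open>u\<close>;
    elsewhere \<open>p\<close> is an arbitrary default.\<close>
  let ?\<phi> = "\<lambda>y. if y \<in> omap i ` states (src i)
    then omap u (inv_into (states (src i)) (omap i) y) else p"
  let ?h = "flat_emap (tgt i) indisc2 ?\<phi> p"
  have ih: "i \<in> homs cat (src i) (tgt i)" using i by (simp add: topcat_homs)
  have uob: "omap u x \<in> {p, q}" if "x \<in> states (src i)" for x
    using hom_omap[OF u' that] by simp
  have h: "?h \<in> homs cat (tgt i) indisc2"
    using topcat_arrowD(2)[OF i(1)]
  proof (rule functor_to_indisc2)
    have "omap u (inv_into (states (src i)) (omap i) y) \<in> {p, q}" if "y \<in> omap i ` states (src i)" for y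
      using uob inv_into_into[OF that] by blast
    then show "?\<phi> \<in> states (tgt i) \<rightarrow> {p, q}" by simp
  qed
  have hi: "comp_emap ?h i \<in> homs cat (src i) indisc2"
    using comp_hom[OF ih h] .
  have "comp_emap ?h i = u"
  proof (rule homs_thin_eqI[OF hi u'])
    show "omap (comp_emap ?h i) a = omap u a" if "a \<in> states (src i)" for a
      using that i(2) hom_omap[OF ih that] by (simp add: compose_def)
  qed
  moreover have "comp_emap collapse ?h = v"
    using comp_hom[OF h collapse_hom] v' by (rule homs_pt_eq)
  ultimately show "\<exists>h\<in>homs cat (tgt i) (src collapse). comp_emap h i = u \<and> comp_emap collapse h = v"
    using h by (auto simp: collapse_def)
qed

lemma DK_trivial_fibrations:
  "Fib MDK \<inter> Weq MDK = rlp cat (I_plus U T (I_gl \<union> C_map))"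
  using DK_model unfolding is_Ilias_model_structure_def generating_cofibrations_def by (elim conjE)

lemma I_plus_arrow: "i \<in> I_plus U T K \<Longrightarrow> i \<in> Ar cat"
  by (simp add: I_plus_def left_adjoint_values_def)

text \<open>The generating cofibrations of the Ilias structure detect its trivial fibrations by
  lifting, and they are injective on objects.\<close>

lemma collapse_trivial_fibration: "collapse \<in> Fib MDK \<inter> Weq MDK"
proof -
  have "has_lifting cat i collapse" if "i \<in> I_plus U T (I_gl \<union> C_map)" for i
    using I_plus_arrow[OF that] I_plus_inj[OF that generators_inj] by (rule lifting_against_collapse)
  then show ?thesis
    unfolding DK_trivial_fibrations rlp_def using hom_arrow[OF collapse_hom] by blast
qed

section \<open>Functors out of the empty category and out of the point\<close>

lemma homs_empty_eq:
  assumes "f \<in> homs cat empt X" "g \<in> homs cat empt X"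
  shows "f = g"
  by (rule emap_eqI[OF homsD(1)[OF assms(1)] homsD(1)[OF assms(2)]])
    (simp_all add: homsD[OF assms(1)] homsD[OF assms(2)] carr_def)

lemma functor_from_empty:
  assumes "is_topcat U T X"
  shows "flat_emap empt X \<phi> c \<in> homs cat empt X"
  using assms by (simp add: topcat_homs topcat_arrow_iff is_semifunctor_def carr_def restrict_def)

text \<open>The only morphism of \<open>pt\<close> is an identity and must go to the identity of
  \<open>x\<close>, which is idempotent by the unit law.\<close>

lemma functor_from_pt:
  assumes X: "is_topcat U T X" and x: "x \<in> states X"
  shows "flat_emap pt X (\<lambda>_. x) (ident X x) \<in> homs cat pt X"
proof -
  have "is_semifunctor (flat_emap pt X (\<lambda>_. x) (ident X x))"
    by (rule flat_emap_semifunctor[OF is_topcat_flow[OF thin_topcats(1)]])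
      (use X x in \<open>auto simp: is_topcat_def\<close>)
  then show ?thesis
    using X by (simp add: topcat_homs topcat_arrow_iff carr_def)
qed

text \<open>Preservation of identities determines the value on the single morphism of
  \<open>pt\<close>.\<close>

lemma homs_from_pt_eq:
  assumes f: "f \<in> homs cat pt X" and g: "g \<in> homs cat pt X" and "omap f p = omap g p"
  shows "f = g"
proof (rule emap_eqI[OF homsD(1)[OF f] homsD(1)[OF g]])
  have "mmap h p p p = ident X (omap h p)" if "h \<in> homs cat pt X" for h
    using topcat_arrowD(4)[OF hom_arrow[OF that], of p] homsD[OF that] by simp
  then have "mmap f p p p = mmap g p p p" using assms by simp
  then show "mmap f a b x = mmap g a b x" if "x \<in> carr (src f) a b" for a b x
    using that homsD(2)[OF f] by (simp add: carr_def split: if_splits)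
qed (use assms(3) homsD[OF f] homsD[OF g] in simp_all)

section \<open>Flows without execution paths and the image of \<open>C\<close> under
  \<open>I_plus\<close>\<close>

lemma is_flow_set_flow:
  assumes "S \<subseteq> {p, q}"
  shows "is_flow U T (set_flow S)"
proof -
  have "continuous_on_product T (discrete_topology {}) (discrete_topology {}) (discrete_topology {})
     (\<lambda>_ _. undefined)"
    by (rule continuous_on_product_point) auto
  then show ?thesis
    using small_sets[OF assms] discrete_in_T[of "{}"] by (auto simp: is_flow_def set_flow_def)
qed

lemma set_flow_simps [simp]:
  "states (set_flow S) = S" "topspace (paths (set_flow S) a b) = {}" "carr (set_flow S) a b = {}"
  by (simp_all add: set_flow_def carr_def)

lemma flow_map_from_set_flow:
  assumes "S \<subseteq> {p, q}" "is_flow U T Y" "\<phi> \<in> S \<rightarrow> states Y"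
  shows "flat_emap (set_flow S) Y \<phi> c \<in> homs (flow_cat U T) (set_flow S) Y"
proof -
  have "is_semifunctor (flat_emap (set_flow S) Y \<phi> c)"
    by (rule flat_emap_semifunctor[OF is_flow_set_flow[OF assms(1)]]) (use assms in auto)
  then show ?thesis
    using assms is_flow_set_flow by (simp add: flow_homs flow_arrow_iff)
qed

text \<open>Assuming extensionality instead of \<open>is_semifunctor\<close> allows composites to be
  compared without first showing that they are arrows of flows.\<close>

lemma flow_maps_from_set_flow_eq:
  fixes f g :: "('u, 'u flow) emap"
  assumes "src f = set_flow S" "src g = set_flow S" "tgt f = tgt g"
    "omap f \<in> extensional S" "omap g \<in> extensional S"
    "\<And>a b. mmap f a b \<in> extensional {}" "\<And>a b. mmap g a b \<in> extensional {}"
    "\<And>a. a \<in> S \<Longrightarrow> omap f a = omap g a"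
  shows "f = g"
proof -
  have "omap f = omap g"
    by (rule extensionalityI) (use assms in auto)
  moreover have "mmap f = mmap g"
    using assms(6,7) by (intro ext) (simp add: extensional_def)
  ultimately show ?thesis using assms(1-3) by simp
qed

lemma flow_comp_eq:
  assumes e: "e \<in> homs (flow_cat U T) (set_flow S) (flow.truncate Y)"
    and h: "h \<in> homs cat Y X" and f: "f \<in> homs (flow_cat U T) (set_flow S) (flow.truncate X)"
    and "\<And>a. a \<in> S \<Longrightarrow> omap h (omap e a) = omap f a"
  shows "comp_emap (onAr forget_ident h) e = f"
proof (rule flow_maps_from_set_flow_eq[of _ S])
  have "is_semifunctor f" using f by (simp add: flow_homs flow_arrow_iff)
  then show "omap f \<in> extensional S" "\<And>a b. mmap f a b \<in> extensional {}"
    using f by (force simp: is_semifunctor_def flow_homs PiE_def)+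
qed (use assms in \<open>auto simp: flow_homs topcat_homs compose_def\<close>)

text \<open>This and \<open>pt_unit\<close> are the units at the source and the target of a copy of
  \<open>C\<close>; \<open>empty_to_pt\<close> is the resulting value of the left adjoint on that
  copy.\<close>

definition empty_unit where
  "empty_unit = flat_emap (set_flow {}) (flow.truncate empt) (\<lambda>_. p) p"

definition pt_unit where
  "pt_unit = flat_emap (set_flow {p}) (flow.truncate pt) (\<lambda>_. p) p"

definition empty_to_pt where
  "empty_to_pt = flat_emap empt pt (\<lambda>_. p) p"

lemma empty_unit_universal:
  "universal_arrow (flow_cat U T) cat forget_ident (set_flow {}) empt empty_unit"
proof -
  have e: "empty_unit \<in> homs (flow_cat U T) (set_flow {}) (flow.truncate empt)"
    unfolding empty_unit_def
    by (rule flow_map_from_set_flow)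
      (use is_topcat_flow[OF thin_topcats(2)] in \<open>auto simp: is_flow_truncate\<close>)
  have "\<exists>!h. h \<in> homs cat empt X \<and> comp_emap (onAr forget_ident h) empty_unit = f"
    if X: "is_topcat U T X" and f: "f \<in> homs (flow_cat U T) (set_flow {}) (flow.truncate X)" for X f
    using functor_from_empty[OF X] flow_comp_eq[OF e _ f] homs_empty_eq[of _ X] by blast
  then show ?thesis using e by (simp only: universal_arrow_iff thin_topcats) blast
qed

text \<open>A map out of the one-state flow and a functor out of \<open>pt\<close> both amount to
  the choice of an object of \<open>X\<close>.\<close>

lemma pt_unit_universal:
  "universal_arrow (flow_cat U T) cat forget_ident (set_flow {p}) pt pt_unit"
proof -
  have e: "pt_unit \<in> homs (flow_cat U T) (set_flow {p}) (flow.truncate pt)"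
    unfolding pt_unit_def
    by (rule flow_map_from_set_flow)
      (use is_topcat_flow[OF thin_topcats(1)] in \<open>auto simp: is_flow_truncate\<close>)
  have "\<exists>!h. h \<in> homs cat pt X \<and> comp_emap (onAr forget_ident h) pt_unit = f"
    if X: "is_topcat U T X" and f: "f \<in> homs (flow_cat U T) (set_flow {p}) (flow.truncate X)" for X f
  proof -
    have x: "omap f p \<in> states X"
      using f semifunctor_omap[of f p] by (simp add: flow_homs flow_arrow_iff)
    let ?h = "flat_emap pt X (\<lambda>_. omap f p) (ident X (omap f p))"
    have h: "?h \<in> homs cat pt X" by (rule functor_from_pt[OF X x])
    have "comp_emap (onAr forget_ident ?h) pt_unit = f"
      by (rule flow_comp_eq[OF e h f]) (simp add: pt_unit_def)
    moreover have "g = ?h" if "g \<in> homs cat pt X" "comp_emap (onAr forget_ident g) pt_unit = f" for g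
    proof (rule homs_from_pt_eq[OF that(1) h])
      have "omap (comp_emap (onAr forget_ident g) pt_unit) p = omap f p" using that(2) by simp
      then show "omap g p = omap ?h p" by (simp add: pt_unit_def compose_def)
    qed
    ultimately show ?thesis using h by blast
  qed
  then show ?thesis using e by (simp only: universal_arrow_iff thin_topcats) blast
qed

lemma empty_to_pt_hom: "empty_to_pt \<in> homs cat empt pt"
  unfolding empty_to_pt_def by (rule functor_from_empty) simp

lemma empty_to_pt_generator: "empty_to_pt \<in> I_plus U T (I_gl \<union> C_map)"
proof -
  let ?k = "flow_inclusion (set_flow {}) (set_flow {p})"
  \<comment> \<open>Both maps consist of functions restricted to the empty set, hence
    coincide.\<close>
  have k: "?k = flat_emap (set_flow {}) (set_flow {p}) id p"
    by (simp add: flow_inclusion_def flat_emap_def restrict_def)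
  have "?k \<in> Ar (flow_cat U T)"
    using flow_map_from_set_flow[of "{}" "set_flow {p}" id p] is_flow_set_flow[of "{p}"]
    by (simp add: k flow_homs)
  moreover have "?k \<in> C_map" by (auto simp: C_map_def)
  moreover have "comp_emap (onAr forget_ident empty_to_pt) empty_unit = comp_emap pt_unit ?k"
    by (rule flow_maps_from_set_flow_eq[of _ "{}"])
      (simp_all add: k empty_to_pt_def empty_unit_def pt_unit_def compose_def restrict_def)
  moreover have "src ?k = set_flow {}" "tgt ?k = set_flow {p}"
    by (simp_all add: k)
  ultimately show ?thesis
    unfolding I_plus_def left_adjoint_values_def topcat_cat_simps flow_cat_simps
    using empty_unit_universal pt_unit_universal homsD(2,3)[OF empty_to_pt_hom] hom_arrow[OF empty_to_pt_hom]
    by (intro CollectI conjI bexI[of _ ?k] exI[of _ empty_unit] exI[of _ pt_unit]) simp_all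
qed

section \<open>Trivial fibrations and weak equivalences of the Ilias structure\<close>

text \<open>An object \<open>y\<close> of the target is a functor from \<open>pt\<close>; lifting it
  against \<open>empty_to_pt\<close> produces a preimage.\<close>

lemma DK_trivial_fibration_surj:
  assumes f: "f \<in> Fib MDK \<inter> Weq MDK"
  shows "omap f ` states (src f) = states (tgt f)"
proof -
  have ar: "f \<in> Ar cat" and lift: "has_lifting cat empty_to_pt f"
    using f empty_to_pt_generator unfolding DK_trivial_fibrations rlp_def by auto
  have "y \<in> omap f ` states (src f)" if y: "y \<in> states (tgt f)" for y
  proof -
    let ?u = "flat_emap empt (src f) (\<lambda>_. p) p"
    let ?v = "flat_emap pt (tgt f) (\<lambda>_. y) (ident (tgt f) y)"
    have u: "?u \<in> homs cat empt (src f)"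
      by (rule functor_from_empty[OF topcat_arrowD(1)[OF ar]])
    have v: "?v \<in> homs cat pt (tgt f)"
      by (rule functor_from_pt[OF topcat_arrowD(2)[OF ar] y])
    have "comp_emap f ?u = comp_emap ?v empty_to_pt"
      by (rule homs_empty_eq[OF comp_hom[OF u] comp_hom[OF empty_to_pt_hom v]])
        (use ar in \<open>simp add: topcat_homs\<close>)
    then obtain h where h: "h \<in> homs cat pt (src f)" "comp_emap f h = ?v"
      using lift u v unfolding has_lifting_def by (auto simp: empty_to_pt_def)
    have "omap (comp_emap f h) p = y" using h(2) by simp
    then have "omap f (omap h p) = y" using h(1) by (simp add: topcat_homs compose_def)
    moreover have "omap h p \<in> states (src f)"
      using hom_omap[OF h(1)] by simp
    ultimately show ?thesis by blast
  qed
  then show ?thesis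
    using semifunctor_omap[OF topcat_arrowD(3)[OF ar]] by blast
qed

text \<open>An identity has the right lifting property against every arrow, with the bottom side
  \<open>v\<close> as lift, so it is a trivial fibration. This avoids a computation with path
  components and homotopy groups.\<close>

lemma identity_weak_equivalence:
  assumes "is_topcat U T X"
  shows "id_emap X \<in> Weq MDK"
proof -
  have id: "id_emap X \<in> homs cat X X"
    by (rule id_hom[OF assms])
  have "has_lifting cat i (id_emap X)" for i
    unfolding has_lifting_def topcat_cat_simps
  proof (intro ballI impI)
    fix u v assume u: "u \<in> homs cat (src i) (src (id_emap X))"
      and v: "v \<in> homs cat (tgt i) (tgt (id_emap X))"
      and sq: "comp_emap (id_emap X) u = comp_emap v i"
    have "u \<in> homs cat (src i) X" "v \<in> homs cat (tgt i) X"
      using u v by (simp_all add: id_emap_def)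
    then have "comp_emap (id_emap X) u = u" "comp_emap (id_emap X) v = v"
      using category_left_unit[OF is_category, of _ _ X] by simp_all
    then show "\<exists>h \<in> homs cat (tgt i) (src (id_emap X)). comp_emap h i = u \<and> comp_emap (id_emap X) h = v"
      using sq v by (intro bexI[of _ v]) (simp_all add: id_emap_def)
  qed
  then have "id_emap X \<in> Fib MDK \<inter> Weq MDK"
    unfolding DK_trivial_fibrations rlp_def using hom_arrow[OF id] by simp
  then show ?thesis by simp
qed

text \<open>Two-out-of-three for the retraction \<open>collapse\<close>: its composite with
  \<open>incl\<close> is the identity because \<open>pt\<close> is terminal.\<close>

lemma incl_weak_equivalence: "incl \<in> Weq MDK"
proof (rule model_two_of_three(2)[OF DK_model_structure incl_hom collapse_hom])
  have "comp_emap collapse incl = id_emap pt"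
    by (rule homs_pt_eq[OF comp_hom[OF incl_hom collapse_hom] id_hom[OF thin_topcats(1)]])
  then show "Cmp cat collapse incl \<in> Weq MDK"
    by (simp add: identity_weak_equivalence)
qed (use collapse_trivial_fibration in simp)

lemma incl_not_surj: "omap incl ` states (src incl) \<noteq> states (tgt incl)"
  using distinct by (auto simp: incl_def)

lemma q_weak_equivalence_bij:
  "f \<in> Weq Mq \<Longrightarrow> bij_betw (omap f) (states (src f)) (states (tgt f))"
  using q_model by (simp add: is_q_model_structure_def q_weak_equivalences_def)

section \<open>The four Quillen conditions\<close>

text \<open>In the factorization of \<open>incl\<close>, the fibration is surjective on objects. If
  the trivial cofibration were a q-weak equivalence, it would be bijective on objects and
  \<open>incl\<close> would be surjective.\<close>

lemma id_not_left_quillen_DK_q: "\<not> left_quillen_adjoint cat MDK cat Mq id_ftr"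
proof
  assume "left_quillen_adjoint cat MDK cat Mq id_ftr"
  then have triv: "Cof MDK \<inter> Weq MDK \<subseteq> Weq Mq"
    by (auto simp: left_quillen_adjoint_def id_ftr_def)
  obtain i f where i: "i \<in> Cof MDK \<inter> Weq MDK" and f: "f \<in> Fib MDK" "tgt i = src f"
    and fi: "comp_emap f i = incl"
    using model_factorization_trivial_cofibration[OF DK_model_structure hom_arrow[OF incl_hom]] by auto
  have "i \<in> homs cat (src i) (tgt i)" "f \<in> homs cat (tgt i) (tgt f)"
    using model_arrows[OF DK_model_structure] i f by (auto simp: topcat_homs)
  then have "f \<in> Weq MDK"
    by (rule model_two_of_three(1)[OF DK_model_structure]) (use i fi incl_weak_equivalence in simp_all)
  then have "omap f ` states (src f) = states (tgt f)"
    using f DK_trivial_fibration_surj by blast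
  moreover have "omap i ` states (src i) = states (tgt i)"
    using q_weak_equivalence_bij[of i] triv i by (auto simp: bij_betw_def)
  ultimately have "omap (comp_emap f i) ` states (src (comp_emap f i)) = states (tgt (comp_emap f i))"
    using f(2) by (auto simp: compose_def image_image[symmetric])
  then show False using incl_not_surj fi by simp
qed

text \<open>In the factorization of \<open>fold2\<close>, the trivial fibration is injective on
  objects, so the cofibration \<open>i\<close> already identifies \<open>p\<close> and
  \<open>q\<close>. As a cofibration for the Ilias structure it would lift against
  \<open>collapse\<close>.\<close>

lemma id_not_left_quillen_q_DK: "\<not> left_quillen_adjoint cat Mq cat MDK id_ftr"
proof
  assume "left_quillen_adjoint cat Mq cat MDK id_ftr"
  then have sub: "Cof Mq \<subseteq> Cof MDK"
    by (auto simp: left_quillen_adjoint_def id_ftr_def)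
  obtain i f where i: "i \<in> Cof Mq" and f: "f \<in> Fib Mq \<inter> Weq Mq" "tgt i = src f"
    and fi: "comp_emap f i = fold2"
    using model_factorization_trivial_fibration[OF q_model_structure hom_arrow[OF fold2_hom]] by auto
  have src: "src i = disc2" using arg_cong[OF fi, of src] by (simp add: fold2_def)
  have iar: "i \<in> Ar cat"
    using model_arrows(1)[OF q_model_structure] i by blast
  have ob: "omap i p \<in> states (src f)" "omap i q \<in> states (src f)"
    using semifunctor_omap[OF topcat_arrowD(3)[OF iar]] src f(2) by auto
  have "omap f (omap i p) = omap f (omap i q)"
    using arg_cong[OF fi, of "\<lambda>g. omap g p"] arg_cong[OF fi, of "\<lambda>g. omap g q"] src
    by (simp add: fold2_def compose_def)
  then have eq: "omap i p = omap i q"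
    using q_weak_equivalence_bij[of f] f(1) ob by (auto simp: bij_betw_def dest: inj_onD)
  let ?v = "flat_emap (tgt i) pt (\<lambda>_. p) p"
  have v: "?v \<in> homs cat (tgt i) pt"
    by (rule functor_to_thin) (use topcat_arrowD(2)[OF iar] in auto)
  \<comment> \<open>The square with top \<open>split2\<close> commutes since \<open>pt\<close> is
    terminal; a lift would make \<open>split2\<close> factor through \<open>i\<close>.\<close>
  have "comp_emap collapse split2 = comp_emap ?v i"
    by (rule homs_pt_eq[OF comp_hom[OF split2_hom collapse_hom] comp_hom[OF _ v]])
      (use iar src in \<open>simp add: topcat_homs\<close>)
  moreover have "has_lifting cat i collapse"
    using model_lifting[OF DK_model_structure _ collapse_trivial_fibration] sub i by blast
  ultimately obtain h where "comp_emap h i = split2"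
    using v split2_hom src homsD(2,3)[OF collapse_hom]
    unfolding has_lifting_def topcat_cat_simps by metis
  then have "omap (comp_emap h i) p = omap split2 p" "omap (comp_emap h i) q = omap split2 q"
    by auto
  then show False using eq src distinct by (simp add: split2_def compose_def)
qed

text \<open>The trivial fibration \<open>collapse\<close> sends both objects to \<open>p\<close>,
  whereas q-weak equivalences are injective on objects.\<close>

lemma id_not_right_quillen_DK_q: "\<not> right_quillen_adjoint cat MDK cat Mq id_ftr"
proof
  assume "right_quillen_adjoint cat MDK cat Mq id_ftr"
  then have "Fib MDK \<inter> Weq MDK \<subseteq> Weq Mq"
    by (auto simp: right_quillen_adjoint_def id_ftr_def)
  then have "inj_on (omap collapse) (states (src collapse))"
    using q_weak_equivalence_bij[of collapse] collapse_trivial_fibration by (auto simp: bij_betw_def)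
  then show False
    using distinct by (simp add: collapse_def inj_on_def)
qed

text \<open>The source has the single pair of objects \<open>p\<close>, \<open>p\<close>, and there
  the functor is a map between one-point spaces; the missed object \<open>q\<close> imposes no
  condition.\<close>

lemma incl_q_fibration: "incl \<in> Fib Mq"
proof -
  have "serre_fibration (paths pt p p) (paths indisc2 p p) (mmap incl p p)"
    using serre_fibration_point[of "mmap incl p p" p p]
    by (simp add: thin_def incl_def carr_def)
  then have "incl \<in> q_fibrations U T"
    using incl_hom by (simp add: q_fibrations_def topcat_homs incl_def)
  then show ?thesis
    using q_model by (simp add: is_q_model_structure_def)
qed

text \<open>Otherwise \<open>incl\<close> would be a trivial fibration of the Ilias structure, hence
  surjective on objects.\<close>

lemma id_not_right_quillen_q_DK: "\<not> right_quillen_adjoint cat Mq cat MDK id_ftr"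
proof
  assume "right_quillen_adjoint cat Mq cat MDK id_ftr"
  then have "incl \<in> Fib MDK"
    using incl_q_fibration by (auto simp: right_quillen_adjoint_def id_ftr_def)
  then show False
    using incl_weak_equivalence DK_trivial_fibration_surj incl_not_surj by blast
qed

end

theorem mainTheorem5:
  fixes U :: "'u set set" and T :: "'u topology set"
    and Mq MDK :: "('u, 'u topcat) emap model"
  assumes "universe U" and "convenient_category U T"
    and "is_q_model_structure U T Mq" and "is_Ilias_model_structure U T MDK"
  shows "\<not> left_quillen_adjoint (topcat_cat U T) MDK (topcat_cat U T) Mq id_ftr \<and>
    \<not> left_quillen_adjoint (topcat_cat U T) Mq (topcat_cat U T) MDK id_ftr \<and>
    \<not> right_quillen_adjoint (topcat_cat U T) MDK (topcat_cat U T) Mq id_ftr \<and>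
    \<not> right_quillen_adjoint (topcat_cat U T) Mq (topcat_cat U T) MDK id_ftr"
proof -
  obtain p q :: 'u where "p \<noteq> q" "\<And>S. S \<subseteq> {p, q} \<Longrightarrow> S \<in> U"
    by (rule universe_small_sets[OF assms(1)]) (rule that)
  then interpret two_model_structures U T Mq MDK p q
    using assms by unfold_locales auto
  show ?thesis
    using id_not_left_quillen_DK_q id_not_left_quillen_q_DK
      id_not_right_quillen_DK_q id_not_right_quillen_q_DK by blast
qed

end
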